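(* Take $p\in [1,\infty)$ and $0<\alpha\le1$. Let $\Omega\subset \mathbb{R}^N$ be a bounded domain satisfying the $(\theta, h)$-uniform interior cone condition. If $v\in\Sigma_\alpha(\Omega)$, then \[ \max_{\Gamma} v - \min_{\Gamma} v \le K\, [v]_{\alpha,\Omega}^{ \frac{N}{N+ \alpha \, p} } \, \Vert v-v_{\Omega}\Vert_{p, \Omega}^\frac{\alpha p}{N+ \alpha p} \] for some optimal constant $K$. Moreover, \[ K \le \max\left[2 \left( 1 +\frac{ \alpha p}{N} \right) , \left(\frac{d_\Omega}{h}\right)^\alpha \left( 1+\sin{ \theta } \right)^\alpha \right]\left( \frac{N}{\alpha p}\right)^{\frac{\alpha p}{N+ \alpha p}}\,\left( \frac{C}{c \, \sin{ \theta } } \right)^\frac{\alpha N}{N+\alpha p}. \]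
   Context: Let $N\ge 2$. Let $A(x)$ be a symmetric $N\times N$ matrix with measurable entries satisfying $\lambda|\xi|^2\le\langle A(x)\xi,\xi\rangle\le\Lambda|\xi|^2$ for all $x$ and $\xi\in\mathbb{R}^N$, with $\lambda,\Lambda>0$, and let $Lv=\mathrm{div}[A(x)\nabla v]$. $\Gamma$ is the boundary of $\Omega$ and $d_\Omega$ its diameter. $\Vert v\Vert_{p,\Omega}$ is the $L^p$-norm of $v$ with respect to the normalized measure $dx/|\Omega|$; $v_\Omega$ is the mean value of $v$ on $\Omega$; $[v]_{\alpha,\Omega}=\sup\{(d_\Omega/2)^\alpha|v(x_1)-v(x_2)|/|x_1-x_2|^\alpha : x_1,x_2\in\overline\Omega,\ x_1\ne x_2\}$; $\Sigma_\alpha(\Omega)$ is the set of weak solutions $v\in C^{0,\alpha}(\overline\Omega)$ of $Lv=0$ in $\Omega$. For $\theta\in[0,\pi/2]$ and $h>0$, $\Omega$ satisfies the $(\theta,h)$-uniform interior cone condition if for every $x\in\Gamma$ there is a finite right spherical cone $\mathcal{C}_x$ with vertex $x$, opening width $\theta$ and height $h$, such that $\mathcal{C}_x\subset\overline\Omega$ and $\overline{\mathcal{C}_x}\cap\Gamma=\{x\}$. The constants $c\le C$, depending only on $N,\lambda,\Lambda$, are those of the mean value property for $L$ (Caffarelli; Blank–Hao): for $x_0\in\Omega$ and $0<r<r_0$ with $r_0\ge\mathrm{dist}(x_0,\Gamma)/C$ there are increasing domains $D_r(x_0)$ with $B_{cr}(x_0)\subset D_r(x_0)\subset B_{Cr}(x_0)$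 such that every $v$ with $Lv\ge0$ satisfies $v(x_0)\le |D_r(x_0)|^{-1}\int_{D_r(x_0)}v\le |D_\rho(x_0)|^{-1}\int_{D_\rho(x_0)}v$ for $0<r<\rho<r_0$. *)

theory Defs
  imports "HOL-Analysis.Analysis"
begin

definition partial :: "'n::finite \<Rightarrow> (real^'n \<Rightarrow> real) \<Rightarrow> real^'n \<Rightarrow> real" where
  "partial i f x = frechet_derivative f (at x) (axis i 1)"

definition grad :: "(real^'n::finite \<Rightarrow> real) \<Rightarrow> real^'n \<Rightarrow> real^'n" where
  "grad f x = (\<chi> i. partial i f x)"

fun Ck :: "nat \<Rightarrow> (real^'n::finite \<Rightarrow> real) \<Rightarrow> bool" where
  "Ck 0 f = continuous_on UNIV f"
| "Ck (Suc k) f = ((\<forall>x. f differentiable (at x)) \<and> continuous_on UNIV f \<and>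
                    (\<forall>i. Ck k (partial i f)))"

definition smooth :: "(real^'n::finite \<Rightarrow> real) \<Rightarrow> bool" where
  "smooth f \<longleftrightarrow> (\<forall>k. Ck k f)"

definition test_fun :: "(real^'n::finite) set \<Rightarrow> (real^'n \<Rightarrow> real) \<Rightarrow> bool" where
  "test_fun \<Omega> \<phi> \<longleftrightarrow> smooth \<phi> \<and> compact (closure {x. \<phi> x \<noteq> 0}) \<and> closure {x. \<phi> x \<noteq> 0} \<subseteq> \<Omega>"

definition L2loc :: "(real^'n::finite) set \<Rightarrow> (real^'n \<Rightarrow> real) \<Rightarrow> bool" where
  "L2loc \<Omega> f \<longleftrightarrow> (\<forall>K. compact K \<and> K \<subseteq> \<Omega> \<longrightarrow>
      f absolutely_integrable_on K \<and> (\<lambda>x. (f x)\<^sup>2) integrable_on K)"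

definition weak_gradient :: "(real^'n::finite) set \<Rightarrow> (real^'n \<Rightarrow> real) \<Rightarrow> (real^'n \<Rightarrow> real^'n) \<Rightarrow> bool" where
  "weak_gradient \<Omega> v g \<longleftrightarrow>
     (\<forall>\<phi> i. test_fun \<Omega> \<phi> \<longrightarrow>
        integral \<Omega> (\<lambda>x. v x * partial i \<phi> x) = - integral \<Omega> (\<lambda>x. g x $ i * \<phi> x))"

definition H1loc_grad :: "(real^'n::finite) set \<Rightarrow> (real^'n \<Rightarrow> real) \<Rightarrow> (real^'n \<Rightarrow> real^'n) \<Rightarrow> bool" where
  "H1loc_grad \<Omega> v g \<longleftrightarrow> L2loc \<Omega> v \<and> (\<forall>i. L2loc \<Omega> (\<lambda>x. g x $ i)) \<and> weak_gradient \<Omega> v g"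

definition weak_subsolution :: "(real^'n::finite \<Rightarrow> real^'n^'n) \<Rightarrow> (real^'n) set \<Rightarrow> (real^'n \<Rightarrow> real) \<Rightarrow> bool" where
  "weak_subsolution A \<Omega> v \<longleftrightarrow> (\<exists>g. H1loc_grad \<Omega> v g \<and>
     (\<forall>\<phi>. test_fun \<Omega> \<phi> \<and> (\<forall>x. \<phi> x \<ge> 0) \<longrightarrow>
        integral \<Omega> (\<lambda>x. (A x *v g x) \<bullet> grad \<phi> x) \<le> 0))"

definition weak_solution :: "(real^'n::finite \<Rightarrow> real^'n^'n) \<Rightarrow> (real^'n) set \<Rightarrow> (real^'n \<Rightarrow> real) \<Rightarrow> bool" where
  "weak_solution A \<Omega> v \<longleftrightarrow> (\<exists>g. H1loc_grad \<Omega> v g \<and>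
     (\<forall>\<phi>. test_fun \<Omega> \<phi> \<longrightarrow> integral \<Omega> (\<lambda>x. (A x *v g x) \<bullet> grad \<phi> x) = 0))"

definition elliptic :: "(real^'n::finite \<Rightarrow> real^'n^'n) \<Rightarrow> real \<Rightarrow> real \<Rightarrow> bool" where
  "elliptic A lam Lam \<longleftrightarrow> 0 < lam \<and> 0 < Lam \<and>
     (\<forall>i j. (\<lambda>x. A x $ i $ j) \<in> borel_measurable lebesgue) \<and>
     (\<forall>x. transpose (A x) = A x) \<and>
     (\<forall>x \<xi>. lam * (norm \<xi>)\<^sup>2 \<le> \<xi> \<bullet> (A x *v \<xi>) \<and> \<xi> \<bullet> (A x *v \<xi>) \<le> Lam * (norm \<xi>)\<^sup>2)"

section \<open>Mean value property (Caffarelli; Blank--Hao) with constants c <= C\<close>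

definition avg :: "(real^'n::finite) set \<Rightarrow> (real^'n \<Rightarrow> real) \<Rightarrow> real" where
  "avg D v = integral D v / measure lebesgue D"

definition mean_value_constants ::
  "(real^'n::finite \<Rightarrow> real^'n^'n) \<Rightarrow> (real^'n) set \<Rightarrow> real \<Rightarrow> real \<Rightarrow> bool" where
  "mean_value_constants A \<Omega> c C \<longleftrightarrow> 0 < c \<and> c \<le> C \<and>
     (\<forall>x0\<in>\<Omega>. \<exists>D :: real \<Rightarrow> (real^'n) set.
        (\<forall>r. 0 < r \<and> r < infdist x0 (frontier \<Omega>) / C \<longrightarrow>
           D r \<in> sets lebesgue \<and> ball x0 (c * r) \<subseteq> D r \<and> D r \<subseteq> ball x0 (C * r)) \<and>
        (\<forall>r \<rho>. 0 < r \<and> r < \<rho> \<and> \<rho> < infdist x0 (frontier \<Omega>) / C \<longrightarrow> D r \<subseteq> D \<rho>) \<and>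
        (\<forall>v. continuous_on \<Omega> v \<and> weak_subsolution A \<Omega> v \<longrightarrow>
           (\<forall>r \<rho>. 0 < r \<and> r < \<rho> \<and> \<rho> < infdist x0 (frontier \<Omega>) / C \<longrightarrow>
              v x0 \<le> avg (D r) v \<and> avg (D r) v \<le> avg (D \<rho>) v)))"

definition mean_val :: "(real^'n::finite) set \<Rightarrow> (real^'n \<Rightarrow> real) \<Rightarrow> real" where
  "mean_val \<Omega> v = integral \<Omega> v / measure lebesgue \<Omega>"

definition npnorm :: "real \<Rightarrow> (real^'n::finite) set \<Rightarrow> (real^'n \<Rightarrow> real) \<Rightarrow> real" where
  "npnorm p \<Omega> v = (integral \<Omega> (\<lambda>x. \<bar>v x\<bar> powr p) / measure lebesgue \<Omega>) powr (1 / p)"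

definition holder_seminorm :: "real \<Rightarrow> (real^'n::finite) set \<Rightarrow> (real^'n \<Rightarrow> real) \<Rightarrow> real" where
  "holder_seminorm \<alpha> \<Omega> v = Sup {(diameter \<Omega> / 2) powr \<alpha> * \<bar>v x1 - v x2\<bar> / dist x1 x2 powr \<alpha> |
       x1 x2. x1 \<in> closure \<Omega> \<and> x2 \<in> closure \<Omega> \<and> x1 \<noteq> x2}"

definition holder :: "real \<Rightarrow> (real^'n::finite) set \<Rightarrow> (real^'n \<Rightarrow> real) \<Rightarrow> bool" where
  "holder \<alpha> S v \<longleftrightarrow> (\<exists>M. \<forall>x\<in>S. \<forall>y\<in>S. \<bar>v x - v y\<bar> \<le> M * dist x y powr \<alpha>)"

definition Sigma_alpha :: "(real^'n::finite \<Rightarrow> real^'n^'n) \<Rightarrow> real \<Rightarrow> (real^'n) set \<Rightarrow> (real^'n \<Rightarrow> real) set" where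
  "Sigma_alpha A \<alpha> \<Omega> = {v. holder \<alpha> (closure \<Omega>) v \<and> weak_solution A \<Omega> v}"

definition spherical_cone :: "real^'n::finite \<Rightarrow> real^'n \<Rightarrow> real \<Rightarrow> real \<Rightarrow> (real^'n) set" where
  "spherical_cone x e \<theta> h = {y. 0 < dist x y \<and> dist x y < h \<and> (y - x) \<bullet> e > norm (y - x) * cos \<theta>}"

definition interior_cone_condition :: "real \<Rightarrow> real \<Rightarrow> (real^'n::finite) set \<Rightarrow> bool" where
  "interior_cone_condition \<theta> h \<Omega> \<longleftrightarrow> (\<forall>x\<in>frontier \<Omega>. \<exists>e. norm e = 1 \<and>
      spherical_cone x e \<theta> h \<subseteq> closure \<Omega> \<and>
      closure (spherical_cone x e \<theta> h) \<inter> frontier \<Omega> = {x})"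

definition osc_ineq :: "real \<Rightarrow> real \<Rightarrow> real \<Rightarrow> (real^'n::finite) set \<Rightarrow> (real^'n \<Rightarrow> real) \<Rightarrow> bool" where
  "osc_ineq K \<alpha> p \<Omega> v \<longleftrightarrow>
     Sup (v ` frontier \<Omega>) - Inf (v ` frontier \<Omega>) \<le>
       K * holder_seminorm \<alpha> \<Omega> v powr (real CARD('n) / (real CARD('n) + \<alpha> * p))
         * npnorm p \<Omega> (\<lambda>x. v x - mean_val \<Omega> v) powr (\<alpha> * p / (real CARD('n) + \<alpha> * p))"

definition optimal_K :: "(real^'n::finite \<Rightarrow> real^'n^'n) \<Rightarrow> real \<Rightarrow> real \<Rightarrow> (real^'n) set \<Rightarrow> real" where
  "optimal_K A \<alpha> p \<Omega> = Inf {K. 0 \<le> K \<and> (\<forall>v\<in>Sigma_alpha A \<alpha> \<Omega>. osc_ineq K \<alpha> p \<Omega> v)}"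

end

theory Submission
  imports Defs
begin

text \<open>
  Move from a boundary point \<open>x\<close> a distance \<open>\<sigma>\<close> along the axis of its cone. The point \<open>y\<close> reached has
  distance at least \<open>\<sigma> sin \<theta>\<close> from the boundary, so the mean value property and Jensen's inequality
  bound \<open>v y - m\<close>, with \<open>m\<close> the mean of \<open>v\<close>, by the \<open>L\<^sup>p\<close> norm times a power of
  \<open>|\<Omega>| / |B\<^bsub>c r\<^esub>|\<close> where \<open>r = \<sigma> sin \<theta> / C\<close>, while \<open>v x - v y\<close> is controlled by the Hoelder
  seminorm. The stated constant results from optimising in \<open>\<sigma>\<close>; if the optimal \<open>\<sigma>\<close> does not fit into
  the cone, the Hoelder bound alone suffices.

  Replacing \<open>|\<Omega>|\<close> by a power of the diameter with no loss of constant requires the isodiametric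
  inequality \<open>|\<Omega>| \<le> |B\<^bsub>d/2\<^esub>|\<close>. It follows from the Brunn--Minkowski inequality for \<open>S\<close> and \<open>-S\<close>,
  since \<open>S - S\<close> lies in a ball of radius \<open>d\<close>; finite unions of boxes are enough for this.
\<close>

section \<open>The Brunn--Minkowski inequality for unions of boxes\<close>

text \<open>Open boxes keep Minkowski sums open, hence measurable; nonempty ones give every nonempty
  family positive volume, so that it can be divided in proportion to volume.\<close>

definition box_family :: "'a::euclidean_space set set \<Rightarrow> bool" where
  "box_family F \<longleftrightarrow> finite F \<and> disjoint F \<and> (\<forall>B\<in>F. B \<noteq> {} \<and> (\<exists>a b. B = box a b))"

lemma box_family_open: "box_family F \<Longrightarrow> open (\<Union>F)"
  by (rule open_Union) (metis box_family_def open_box)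

lemma box_family_bounded: "box_family F \<Longrightarrow> bounded (\<Union>F)"
  by (rule bounded_Union) (auto simp: box_family_def)

lemma box_family_lmeasurable: "box_family F \<Longrightarrow> \<Union>F \<in> lmeasurable"
  by (simp add: box_family_bounded box_family_open lmeasurable_open)

lemma box_family_measure_pos:
  assumes "box_family F" "F \<noteq> {}"
  shows "0 < measure lebesgue (\<Union>F)"
proof -
  have "\<Union>F \<noteq> {}"
    using assms unfolding box_family_def by blast
  then have "\<not> negligible (\<Union>F)"
    using open_not_negligible box_family_open[OF assms(1)] by blast
  then show ?thesis
    using box_family_lmeasurable[OF assms(1)] negligible_iff_measure zero_less_measure_iff by blast
qed

section \<open>Cutting box families by coordinate hyperplanes\<close>

lemma box_Int_halfspace_lt:
  fixes a :: "'a::euclidean_space"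
  assumes "i \<in> Basis"
  shows "\<exists>c d. box a b \<inter> {x. x \<bullet> i < t} = box c d"
proof -
  have "box a b \<inter> {x. x \<bullet> i < t} = box a (\<Sum>j\<in>Basis. (if j = i then min t (b \<bullet> i) else b \<bullet> j) *\<^sub>R j)"
    using assms by (auto simp: mem_box split: if_splits)
  then show ?thesis by blast
qed

lemma box_Int_halfspace_gt:
  fixes a :: "'a::euclidean_space"
  assumes "i \<in> Basis"
  shows "\<exists>c d. box a b \<inter> {x. x \<bullet> i > t} = box c d"
proof -
  have "box a b \<inter> {x. x \<bullet> i > t} = box (\<Sum>j\<in>Basis. (if j = i then max t (a \<bullet> i) else a \<bullet> j) *\<^sub>R j) b"
    using assms by (auto simp: mem_box split: if_splits)
  then show ?thesis by blast
qed

text \<open>Empty intersections are discarded, so a box that misses \<open>H\<close> lowers the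
  number of boxes. This strict drop drives the induction for Brunn--Minkowski; \<open>H\<close> is
  abstract in order to serve both sides of a hyperplane.\<close>

lemma box_family_Int:
  assumes F: "box_family F"
    and H: "\<And>a b. \<exists>c d. box a b \<inter> H = box c d"
  obtains F' where "box_family F'" "\<Union>F' = \<Union>F \<inter> H" "card F' \<le> card F"
    "\<And>B. B \<in> F \<Longrightarrow> B \<inter> H = {} \<Longrightarrow> card F' < card F"
proof -
  have fin: "finite F" and dis: "disjoint F" and bx: "\<And>B. B \<in> F \<Longrightarrow> B \<noteq> {} \<and> (\<exists>a b. B = box a b)"
    using F by (auto simp: box_family_def)
  define F' where "F' = (\<lambda>B. B \<inter> H) ` F - {{}}"
  have "disjoint F'"
  proof (rule disjointI)
    fix B B' assume "B \<in> F'" "B' \<in> F'" "B \<noteq> B'"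
    then obtain C C' where "B = C \<inter> H" "B' = C' \<inter> H" "C \<in> F" "C' \<in> F" "C \<noteq> C'"
      by (auto simp: F'_def)
    then show "B \<inter> B' = {}"
      using disjointD[OF dis, of C C'] by blast
  qed
  moreover have "B \<noteq> {} \<and> (\<exists>a b. B = box a b)" if B: "B \<in> F'" for B
  proof -
    obtain C where C: "C \<in> F" "B = C \<inter> H" "B \<noteq> {}"
      using B by (auto simp: F'_def)
    with bx[of C] H show ?thesis by auto
  qed
  ultimately have 1: "box_family F'"
    using fin by (auto simp: box_family_def F'_def)
  have 2: "\<Union>F' = \<Union>F \<inter> H"
    by (auto simp: F'_def)
  have 3: "card F' \<le> card F"
    by (metis F'_def card_Diff1_le card_image_le fin le_trans)
  have 4: "card F' < card F" if "B \<in> F" "B \<inter> H = {}" for B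
  proof -
    have "F' \<subseteq> (\<lambda>B. B \<inter> H) ` (F - {B})"
      using that by (auto simp: F'_def)
    then have "card F' \<le> card (F - {B})"
      by (meson card_image_le card_mono fin finite_Diff finite_imageI le_trans)
    also have "\<dots> < card F"
      using fin that(1) by (rule card_Diff1_less)
    finally show ?thesis .
  qed
  show thesis
    using that 1 2 3 4 by blast
qed

text \<open>The intersection of two disjoint boxes is an empty box, so in some coordinate the two
  side intervals are disjoint; an endpoint of one of them gives the hyperplane.\<close>

lemma box_family_separation:
  fixes F :: "'a::euclidean_space set set"
  assumes F: "box_family F" and "card F \<ge> 2"
  obtains i t B B' where "i \<in> Basis" "B \<in> F" "B' \<in> F" "B \<noteq> {}" "B' \<noteq> {}"
    "B \<subseteq> {x. x \<bullet> i < t}" "B' \<subseteq> {x. x \<bullet> i > t}"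
proof -
  obtain B B' where B: "B \<in> F" "B' \<in> F" "B \<noteq> B'"
    by (metis One_nat_def Suc_1 Suc_n_not_le_n assms(2) card.infinite card_le_Suc0_iff_eq le_trans zero_le)
  then obtain a b c d where ab: "B = box a b" "B \<noteq> {}" "B' = box c d" "B' \<noteq> {}"
    using F unfolding box_family_def by meson
  have "B \<inter> B' = {}"
    using F B by (auto simp: box_family_def disjoint_def)
  then obtain i where i: "i \<in> Basis" "min (b \<bullet> i) (d \<bullet> i) \<le> max (a \<bullet> i) (c \<bullet> i)"
    unfolding ab box_Int_box box_eq_empty by auto
  have "a \<bullet> i < b \<bullet> i" "c \<bullet> i < d \<bullet> i"
    using ab i by (auto simp: box_ne_empty)
  then consider "b \<bullet> i \<le> c \<bullet> i" | "d \<bullet> i \<le> a \<bullet> i"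
    using i(2) by linarith
  then show thesis
  proof cases
    case 1
    show thesis
      by (rule that[of i B B' "b \<bullet> i"]) (use 1 ab B i in \<open>force simp: mem_box\<close>)+
  next
    case 2
    show thesis
      by (rule that[of i B' B "a \<bullet> i"]) (use 2 ab B i in \<open>force simp: mem_box\<close>)+
  qed
qed

section \<open>Volumes cut off by a moving hyperplane\<close>

lemma measure_halfspace_split:
  fixes S :: "'a::euclidean_space set"
  assumes S: "S \<in> lmeasurable" and i: "i \<in> Basis"
  shows "measure lebesgue S =
    measure lebesgue (S \<inter> {x. x \<bullet> i < t}) + measure lebesgue (S \<inter> {x. x \<bullet> i > t})"
proof -
  have o: "{x::'a. x \<bullet> i < t} \<in> sets lebesgue" "{x::'a. x \<bullet> i > t} \<in> sets lebesgue"
    using open_halfspace_component_lt open_halfspace_component_gt by (auto intro: borel_open)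
  then have m: "S \<inter> {x. x \<bullet> i < t} \<in> lmeasurable" "S \<inter> {x. x \<bullet> i > t} \<in> lmeasurable"
    using S by (auto simp: fmeasurable_Int_fmeasurable)
  have neg: "negligible {x. x \<bullet> i = t}"
    using i negligible_standard_hyperplane by blast
  have "measure lebesgue S =
      measure lebesgue ((S \<inter> {x. x \<bullet> i < t}) \<union> (S \<inter> {x. x \<bullet> i > t}))"
  proof (rule measure_negligible_symdiff[OF S, symmetric])
    show "negligible (sym_diff S (S \<inter> {x. x \<bullet> i < t} \<union> S \<inter> {x. t < x \<bullet> i}))"
      by (rule negligible_subset[OF neg]) auto
  qed
  also have "\<dots> = measure lebesgue (S \<inter> {x. x \<bullet> i < t}) + measure lebesgue (S \<inter> {x. x \<bullet> i > t})"
    by (rule measure_Un_AE) (use m in auto)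
  finally show ?thesis .
qed

text \<open>Moving the threshold within distance \<open>d\<close> of \<open>c\<close> changes the
  volume by at most that of a slab of half-width \<open>d\<close> inside a bounding box, and thin
  slabs have small volume.\<close>

lemma continuous_measure_halfspace:
  fixes S :: "'a::euclidean_space set"
  assumes S: "S \<in> lmeasurable" "bounded S" and i: "i \<in> Basis"
  shows "continuous_on UNIV (\<lambda>t. measure lebesgue (S \<inter> {x. x \<bullet> i < t}))"
proof -
  let ?g = "\<lambda>t. measure lebesgue (S \<inter> {x. x \<bullet> i < t})"
  have o: "{x::'a. x \<bullet> i < t} \<in> sets lebesgue" for t
    using open_halfspace_component_lt by (auto intro: borel_open)
  have m: "S \<inter> {x. x \<bullet> i < t} \<in> lmeasurable" for t
    using S o by (auto simp: fmeasurable_Int_fmeasurable)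
  obtain a b where ab: "S \<subseteq> cbox a b"
    using S(2) bounded_subset_cbox_symmetric by blast
  have bound: "?g t' - ?g t \<le> measure lborel (cbox a b \<inter> {x. \<bar>x \<bullet> i - c\<bar> \<le> d})"
    if "\<bar>t - c\<bar> \<le> d" "\<bar>t' - c\<bar> \<le> d" for t t' c d
  proof -
    have cl: "closed {x. \<bar>x \<bullet> i - c\<bar> \<le> d}"
      by (intro closed_Collect_le continuous_intros)
    then have K: "compact (cbox a b \<inter> {x. \<bar>x \<bullet> i - c\<bar> \<le> d})"
      by (simp add: compact_Int_closed)
    have "?g t' \<le> measure lebesgue ((S \<inter> {x. x \<bullet> i < t}) \<union> (cbox a b \<inter> {x. \<bar>x \<bullet> i - c\<bar> \<le> d}))"
      by (rule measure_mono_fmeasurable) (use m K lmeasurable_compact that ab in \<open>auto simp: fmeasurableD\<close>)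
    also have "\<dots> \<le> ?g t + measure lebesgue (cbox a b \<inter> {x. \<bar>x \<bullet> i - c\<bar> \<le> d})"
      by (rule measure_Un_le) (use m K lmeasurable_compact in \<open>auto simp: fmeasurableD\<close>)
    finally show ?thesis
      using K by (simp add: borel_compact)
  qed
  show ?thesis
    unfolding continuous_on_iff
  proof (intro ballI allI impI)
    fix c e :: real assume "0 < e"
    then obtain d where d: "0 < d" "measure lborel (cbox a b \<inter> {x. \<bar>x \<bullet> i - c\<bar> \<le> d}) < e"
      using content_doublesplit i by blast
    have "dist (?g t) (?g c) < e" if "dist t c < d" for t
      using bound[of t c d c] bound[of c c d t] d that by (auto simp: dist_real_def)
    then show "\<exists>d>0. \<forall>t\<in>UNIV. dist t c < d \<longrightarrow> dist (?g t) (?g c) < e"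
      using d by blast
  qed
qed

text \<open>Intermediate value theorem: the continuous cut-off volume runs from 0 to the full volume
  of \<open>S\<close>.\<close>

lemma ex_halfspace_measure_fraction:
  fixes S :: "'a::euclidean_space set"
  assumes S: "S \<in> lmeasurable" "bounded S" and i: "i \<in> Basis" and l: "0 \<le> l" "l \<le> 1"
  obtains t where "measure lebesgue (S \<inter> {x. x \<bullet> i < t}) = l * measure lebesgue S"
proof -
  obtain R where R: "\<And>x. x \<in> S \<Longrightarrow> norm x \<le> R"
    using S(2) bounded_iff by blast
  \<comment> \<open>\<open>R\<close> may be negative when \<open>S\<close> is empty. The absolute
    value gives an ordered interval, and the added 1 gives strict bounds, so that the extreme
    half-spaces miss and contain \<open>S\<close>.\<close>
  define r where "r = \<bar>R\<bar> + 1"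
  have r0: "-r \<le> r" by (simp add: r_def)
  have r: "\<bar>x \<bullet> i\<bar> < r" if "x \<in> S" for x
    using Basis_le_norm[OF i, of x] R[OF that] by (auto simp: r_def)
  have *: "S \<inter> {x. x \<bullet> i < - r} = {}" "S \<inter> {x. x \<bullet> i < r} = S"
    using r by (fastforce simp: abs_less_iff)+
  have "\<exists>t\<ge>-r. t \<le> r \<and> measure lebesgue (S \<inter> {x. x \<bullet> i < t}) = l * measure lebesgue S"
  proof (rule IVT')
    show "continuous_on {-r..r} (\<lambda>t. measure lebesgue (S \<inter> {x. x \<bullet> i < t}))"
      using continuous_measure_halfspace[OF S i] continuous_on_subset by blast
  qed (use l r0 in \<open>auto simp: * mult_left_le_one_le\<close>)
  then show thesis using that by blast
qed

text \<open>The arithmetic-geometric mean inequality is applied to the ratios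
  \<open>x i / (x i + y i)\<close> and \<open>y i / (x i + y i)\<close>, whose arithmetic means add
  up to 1. With side lengths for \<open>x\<close> and \<open>y\<close> this is Brunn--Minkowski for
  two boxes.\<close>

lemma root_prod_add_le:
  fixes x y :: "'b \<Rightarrow> real"
  assumes S: "finite S" "S \<noteq> {}" and x: "\<And>i. i \<in> S \<Longrightarrow> 0 < x i" and y: "\<And>i. i \<in> S \<Longrightarrow> 0 < y i"
  shows "root (card S) (\<Prod>i\<in>S. x i) + root (card S) (\<Prod>i\<in>S. y i) \<le> root (card S) (\<Prod>i\<in>S. x i + y i)"
proof -
  let ?n = "card S"
  have n: "0 < ?n" using S by (simp add: card_gt_0_iff)
  let ?P = "\<Prod>i\<in>S. x i + y i"
  have P: "0 < ?P" by (intro prod_pos) (simp add: x y add_pos_pos)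
  have amgm: "root ?n (\<Prod>i\<in>S. z i / (x i + y i)) \<le> (\<Sum>i\<in>S. z i / (x i + y i) / ?n)"
    if "\<And>i. i \<in> S \<Longrightarrow> 0 < z i" for z :: "'b \<Rightarrow> real"
  proof -
    have "0 < (\<Prod>i\<in>S. z i / (x i + y i))"
      by (intro prod_pos) (simp add: x y that add_pos_pos)
    then show ?thesis
      using arith_geom_mean[OF S, of "\<lambda>i. z i / (x i + y i)"] that x y n
      by (simp add: root_powr_inverse add_pos_pos less_imp_le inverse_eq_divide)
  qed
  have "root ?n (\<Prod>i\<in>S. x i / (x i + y i)) + root ?n (\<Prod>i\<in>S. y i / (x i + y i))
      \<le> (\<Sum>i\<in>S. x i / (x i + y i) / ?n) + (\<Sum>i\<in>S. y i / (x i + y i) / ?n)"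
    using amgm[of x] amgm[of y] x y by (simp add: add_mono)
  also have "\<dots> = (\<Sum>i\<in>S. 1 / ?n)"
    unfolding sum.distrib[symmetric] using x y
    by (intro sum.cong refl)
      (metis add_divide_distrib add_pos_pos divide_self less_irrefl)
  also have "\<dots> = 1" using n by simp
  finally have "root ?n (\<Prod>i\<in>S. x i) / root ?n ?P + root ?n (\<Prod>i\<in>S. y i) / root ?n ?P \<le> 1"
    by (simp add: prod_dividef real_root_divide)
  then show ?thesis
    using P n by (simp add: divide_simps real_root_gt_zero split: if_splits)
qed

text \<open>A point of the left-hand box is split by dividing the corresponding sides of the two
  summands in the same ratio, coordinate by coordinate.\<close>

lemma box_plus_box:
  fixes a :: "'a::euclidean_space"
  assumes "box a b \<noteq> {}" "box c d \<noteq> {}"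
  shows "box (a + c) (b + d) \<subseteq> box a b + box c d"
proof
  fix z assume z: "z \<in> box (a + c) (b + d)"
  have l: "a \<bullet> i < b \<bullet> i" "c \<bullet> i < d \<bullet> i" if "i \<in> Basis" for i
    using assms that by (auto simp: box_ne_empty)
  \<comment> \<open>The relative position of \<open>z\<close> along the \<open>i\<close>-th side,
    strictly between 0 and 1.\<close>
  define \<tau> where "\<tau> i = ((z - a - c) \<bullet> i) / ((b + d - a - c) \<bullet> i)" for i
  have \<tau>: "0 < \<tau> i" "\<tau> i < 1" "\<tau> i * ((b - a) \<bullet> i + (d - c) \<bullet> i) = (z - a - c) \<bullet> i" if i: "i \<in> Basis" for i
    using z l[OF i] i by (auto simp: \<tau>_def mem_box inner_simps field_simps)
  define u where "u = (\<Sum>i\<in>Basis. (a \<bullet> i + \<tau> i * ((b - a) \<bullet> i)) *\<^sub>R i)"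
  define w where "w = (\<Sum>i\<in>Basis. (c \<bullet> i + \<tau> i * ((d - c) \<bullet> i)) *\<^sub>R i)"
  have in_between: "s < s + t * (s' - s) \<and> s + t * (s' - s) < s'" if "0 < t" "t < 1" "s < s'" for s s' t :: real
  proof -
    have "0 < t * (s' - s)" "0 < (1 - t) * (s' - s)" using that by auto
    then show ?thesis by (simp add: algebra_simps)
  qed
  have "u \<in> box a b" "w \<in> box c d"
    unfolding u_def w_def mem_box using in_between \<tau> l by (auto simp: inner_diff_left)
  moreover have "z = u + w"
  proof (rule euclidean_eqI)
    fix i :: 'a assume i: "i \<in> Basis"
    then show "z \<bullet> i = (u + w) \<bullet> i"
    proof -
      have "(u + w) \<bullet> i = (a \<bullet> i + \<tau> i * ((b - a) \<bullet> i)) + (c \<bullet> i + \<tau> i * ((d - c) \<bullet> i))"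
        using i by (simp add: u_def w_def inner_add_left)
      then show ?thesis
        using \<tau>(3)[OF i] by (simp add: inner_diff_left algebra_simps)
    qed
  qed
  ultimately show "z \<in> box a b + box c d"
    by (auto simp: set_plus_def)
qed

lemma open_set_plus: "open A \<Longrightarrow> open (A + B)" for A B :: "'a::real_normed_vector set"
  using open_sums[of A B] by (simp add: set_plus_def UNION_eq Bex_def)

lemma bounded_set_plus: "bounded A \<Longrightarrow> bounded B \<Longrightarrow> bounded (A + B)" for A B :: "'a::real_normed_vector set"
  using bounded_sums[of A B] by (simp add: set_plus_def UNION_eq Bex_def)

lemma brunn_minkowski_box:
  fixes a b c d :: "'a::euclidean_space"
  assumes ne: "box a b \<noteq> {}" "box c d \<noteq> {}"
  shows "root DIM('a) (measure lebesgue (box a b)) + root DIM('a) (measure lebesgue (box c d))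
    \<le> root DIM('a) (measure lebesgue (box a b + box c d))"
proof -
  have l: "a \<bullet> i < b \<bullet> i" "c \<bullet> i < d \<bullet> i" if "i \<in> Basis" for i
    using assms that by (auto simp: box_ne_empty)
  have m: "measure lebesgue (box a b) = (\<Prod>i\<in>Basis. (b - a) \<bullet> i)"
    "measure lebesgue (box c d) = (\<Prod>i\<in>Basis. (d - c) \<bullet> i)"
    using l by (auto simp: measure_lborel_box_eq less_imp_le)
  have "root DIM('a) (measure lebesgue (box a b)) + root DIM('a) (measure lebesgue (box c d))
    \<le> root DIM('a) (\<Prod>i\<in>Basis. (b - a) \<bullet> i + (d - c) \<bullet> i)"
    unfolding m by (rule root_prod_add_le) (auto simp: l inner_diff_left)
  also have "(\<Prod>i\<in>Basis. (b - a) \<bullet> i + (d - c) \<bullet> i) = measure lebesgue (box (a + c) (b + d))"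
    using l by (auto simp: measure_lborel_box_eq inner_simps add_mono less_imp_le algebra_simps)
  also have "root DIM('a) \<dots> \<le> root DIM('a) (measure lebesgue (box a b + box c d))"
    by (intro real_root_le_mono measure_mono_fmeasurable box_plus_box[OF ne] lmeasurable_open
        open_set_plus bounded_set_plus) auto
  finally show ?thesis .
qed

text \<open>The Hadwiger--Ohmann induction: a hyperplane separating two boxes of one family cuts off a
  fraction of its volume; a parallel hyperplane cuts off the same fraction of the other family, and
  both pairs of parts consist of fewer boxes.\<close>

lemma brunn_minkowski_step:
  fixes F G :: "'a::euclidean_space set set"
  assumes F: "box_family F" "card F \<ge> 2" and G: "box_family G" "G \<noteq> {}"
    and IH: "\<And>F' G' :: 'a set set. box_family F' \<Longrightarrow> F' \<noteq> {} \<Longrightarrow> box_family G' \<Longrightarrow> G' \<noteq> {} \<Longrightarrow>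
      card F' + card G' < card F + card G \<Longrightarrow>
      root DIM('a) (measure lebesgue (\<Union>F')) + root DIM('a) (measure lebesgue (\<Union>G'))
      \<le> root DIM('a) (measure lebesgue (\<Union>F' + \<Union>G'))"
  shows "root DIM('a) (measure lebesgue (\<Union>F)) + root DIM('a) (measure lebesgue (\<Union>G))
    \<le> root DIM('a) (measure lebesgue (\<Union>F + \<Union>G))"
proof -
  let ?n = "DIM('a)" and ?m = "measure (lebesgue :: 'a measure)"
  let ?r = "root ?n (?m (\<Union>F)) + root ?n (?m (\<Union>G))"
  obtain i t B B' where it: "i \<in> Basis" "B \<in> F" "B' \<in> F" "B \<noteq> {}" "B' \<noteq> {}"
    "B \<subseteq> {x. x \<bullet> i < t}" "B' \<subseteq> {x. x \<bullet> i > t}"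
    by (rule box_family_separation[OF F])
  \<comment> \<open>The part of \<open>F\<close> below \<open>t\<close> loses the box
    \<open>B'\<close> and keeps \<open>B\<close>; the part above \<open>t\<close> loses
    \<open>B\<close> and keeps \<open>B'\<close>. Both are nonempty with fewer boxes than
    \<open>F\<close>.\<close>
  obtain F1 where F1: "box_family F1" "\<Union>F1 = \<Union>F \<inter> {x. x \<bullet> i < t}" "card F1 < card F"
  proof (rule box_family_Int[OF F(1) box_Int_halfspace_lt[OF it(1)], of t])
    fix F' assume "box_family F'" "\<Union>F' = \<Union>F \<inter> {x. x \<bullet> i < t}"
      "\<And>B. B \<in> F \<Longrightarrow> B \<inter> {x. x \<bullet> i < t} = {} \<Longrightarrow> card F' < card F"
    moreover have "B' \<inter> {x. x \<bullet> i < t} = {}" using it(7) by force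
    ultimately show thesis using that it(3) by blast
  qed
  obtain F2 where F2: "box_family F2" "\<Union>F2 = \<Union>F \<inter> {x. x \<bullet> i > t}" "card F2 < card F"
  proof (rule box_family_Int[OF F(1) box_Int_halfspace_gt[OF it(1)], of t])
    fix F' assume "box_family F'" "\<Union>F' = \<Union>F \<inter> {x. x \<bullet> i > t}"
      "\<And>B. B \<in> F \<Longrightarrow> B \<inter> {x. x \<bullet> i > t} = {} \<Longrightarrow> card F' < card F"
    moreover have "B \<inter> {x. x \<bullet> i > t} = {}" using it(6) by force
    ultimately show thesis using that it(2) by blast
  qed
  have "\<Union>F1 \<noteq> {}" "\<Union>F2 \<noteq> {}"
    unfolding F1 F2 using it by auto
  then have ne: "F1 \<noteq> {}" "F2 \<noteq> {}" by auto
  have pF: "0 < ?m (\<Union>F)" "0 < ?m (\<Union>F1)" "0 < ?m (\<Union>F2)" "0 < ?m (\<Union>G)"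
    using box_family_measure_pos F1(1) F2(1) F(1) G it(2) ne by blast+
  have sF: "?m (\<Union>F) = ?m (\<Union>F1) + ?m (\<Union>F2)"
    unfolding F1 F2 using box_family_lmeasurable[OF F(1)] it(1) by (rule measure_halfspace_split)
  define l where "l = ?m (\<Union>F1) / ?m (\<Union>F)"
  have l: "0 < l" "l < 1" "?m (\<Union>F1) = l * ?m (\<Union>F)" "?m (\<Union>F2) = (1 - l) * ?m (\<Union>F)"
    using pF sF by (auto simp: l_def field_simps)
  obtain s where s: "?m (\<Union>G \<inter> {x. x \<bullet> i < s}) = l * ?m (\<Union>G)"
    using ex_halfspace_measure_fraction[OF box_family_lmeasurable[OF G(1)] box_family_bounded[OF G(1)] it(1), of l] l
    by auto
  obtain G1 where G1: "box_family G1" "\<Union>G1 = \<Union>G \<inter> {x. x \<bullet> i < s}" "card G1 \<le> card G"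
    using box_family_Int[OF G(1) box_Int_halfspace_lt[OF it(1)], of s] by metis
  obtain G2 where G2: "box_family G2" "\<Union>G2 = \<Union>G \<inter> {x. x \<bullet> i > s}" "card G2 \<le> card G"
    using box_family_Int[OF G(1) box_Int_halfspace_gt[OF it(1)], of s] by metis
  have sG: "?m (\<Union>G) = ?m (\<Union>G1) + ?m (\<Union>G2)"
    unfolding G1 G2 using box_family_lmeasurable[OF G(1)] it(1) by (rule measure_halfspace_split)
  have lG: "?m (\<Union>G1) = l * ?m (\<Union>G)" "?m (\<Union>G2) = (1 - l) * ?m (\<Union>G)"
    using s sG by (auto simp: G1(2) algebra_simps)
  have neG: "G1 \<noteq> {}" "G2 \<noteq> {}"
    using lG l pF by auto
  have IH1: "root ?n (?m (\<Union>F1)) + root ?n (?m (\<Union>G1)) \<le> root ?n (?m (\<Union>F1 + \<Union>G1))"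
    using F1 G1 ne neG by (intro IH) auto
  have IH2: "root ?n (?m (\<Union>F2)) + root ?n (?m (\<Union>G2)) \<le> root ?n (?m (\<Union>F2 + \<Union>G2))"
    using F2 G2 ne neG by (intro IH) auto
  \<comment> \<open>By homogeneity of the root, the induction hypothesis for parts with the same
    fraction \<open>q\<close> of both volumes bounds \<open>q\<close> times the \<open>n\<close>-th
    power of the full sum of roots.\<close>
  have scale: "q * ?r ^ ?n \<le> X" if "0 < q" "0 \<le> X" "root ?n (q * ?m (\<Union>F)) + root ?n (q * ?m (\<Union>G)) \<le> root ?n X" for q X
  proof -
    have "root ?n q * ?r \<le> root ?n X"
      using that by (simp add: real_root_mult distrib_left)
    then have "(root ?n q * ?r) ^ ?n \<le> root ?n X ^ ?n"
      using that pF by (intro power_mono) auto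
    then show ?thesis
      using that by (simp add: power_mult_distrib real_root_pow_pos2)
  qed
  have P1: "l * ?r ^ ?n \<le> ?m (\<Union>F1 + \<Union>G1)"
    by (rule scale) (use IH1 l lG in auto)
  have P2: "(1 - l) * ?r ^ ?n \<le> ?m (\<Union>F2 + \<Union>G2)"
    by (rule scale) (use IH2 l lG in auto)
  have meas: "\<Union>F' + \<Union>G' \<in> lmeasurable" if "box_family F'" "box_family G'" for F' G' :: "'a set set"
    using that by (simp add: lmeasurable_open open_set_plus bounded_set_plus box_family_open box_family_bounded)
  \<comment> \<open>The sums of matching parts lie on opposite sides of the hyperplane at
    \<open>t + s\<close>, so their volumes add up inside the full sum.\<close>
  have disj: "(\<Union>F1 + \<Union>G1) \<inter> (\<Union>F2 + \<Union>G2) = {}"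
  proof -
    have "\<Union>F1 + \<Union>G1 \<subseteq> {x. x \<bullet> i < t + s}" "\<Union>F2 + \<Union>G2 \<subseteq> {x. x \<bullet> i > t + s}"
      unfolding F1 F2 G1 G2 by (auto simp: set_plus_def inner_add_left intro: add_strict_mono)
    then show ?thesis by fastforce
  qed
  have "?r ^ ?n \<le> ?m (\<Union>F1 + \<Union>G1) + ?m (\<Union>F2 + \<Union>G2)"
    using P1 P2 by (simp add: algebra_simps)
  also have "\<dots> = ?m ((\<Union>F1 + \<Union>G1) \<union> (\<Union>F2 + \<Union>G2))"
    by (rule measure_Un_AE[symmetric]) (use meas[OF F1(1) G1(1)] meas[OF F2(1) G2(1)] disj in auto)
  also have "\<dots> \<le> ?m (\<Union>F + \<Union>G)"
  proof (rule measure_mono_fmeasurable)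
    show "(\<Union>F1 + \<Union>G1) \<union> (\<Union>F2 + \<Union>G2) \<subseteq> \<Union>F + \<Union>G"
      unfolding F1 F2 G1 G2 by (auto simp: set_plus_def)
  qed (use meas[OF F1(1) G1(1)] meas[OF F2(1) G2(1)] meas[OF F(1) G(1)] in \<open>auto simp: fmeasurableD\<close>)
  finally have "root ?n (?r ^ ?n) \<le> root ?n (?m (\<Union>F + \<Union>G))"
    by simp
  then show ?thesis
    using pF by (simp add: real_root_power_cancel)
qed

text \<open>Induction on the total number of boxes, with one box against one box as the base.
  Minkowski addition commutes, so the step may cut whichever family has at least two boxes.\<close>

lemma brunn_minkowski_box_family:
  fixes F G :: "'a::euclidean_space set set"
  assumes "box_family F" "F \<noteq> {}" "box_family G" "G \<noteq> {}"
  shows "root DIM('a) (measure lebesgue (\<Union>F)) + root DIM('a) (measure lebesgue (\<Union>G))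
    \<le> root DIM('a) (measure lebesgue (\<Union>F + \<Union>G))"
  using assms
proof (induction "card F + card G" arbitrary: F G rule: less_induct)
  case less
  have fin: "finite F" "finite G" using less.prems by (auto simp: box_family_def)
  then have "card F \<noteq> 0" "card G \<noteq> 0" using less.prems by auto
  then consider "card F \<ge> 2" | "card G \<ge> 2" | "card F = 1" "card G = 1" by linarith
  then show ?case
  proof cases
    case 1
    show ?thesis
      by (rule brunn_minkowski_step[OF less.prems(1) 1 less.prems(3,4)], rule less.hyps)
  next
    case 2
    have "root DIM('a) (measure lebesgue (\<Union>G)) + root DIM('a) (measure lebesgue (\<Union>F))
        \<le> root DIM('a) (measure lebesgue (\<Union>G + \<Union>F))"
      by (rule brunn_minkowski_step[OF less.prems(3) 2 less.prems(1,2)], rule less.hyps) (simp_all add: add.commute)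
    then show ?thesis
      by (simp add: add.commute)
  next
    case 3
    then obtain A B where AB: "F = {A}" "G = {B}" by (metis card_1_singletonE)
    have "A \<noteq> {} \<and> (\<exists>a b. A = box a b)" "B \<noteq> {} \<and> (\<exists>a b. B = box a b)"
      using less.prems unfolding AB box_family_def by blast+
    then obtain a b c d where "A = box a b" "A \<noteq> {}" "B = box c d" "B \<noteq> {}"
      by blast
    then show ?thesis
      using brunn_minkowski_box[of a b c d] unfolding AB by simp
  qed
qed

section \<open>The isodiametric inequality\<close>

lemma uminus_image_box: "uminus ` box a b = box (- b) (- a)" for a b :: "'a::euclidean_space"
proof -
  have "x \<in> uminus ` box a b" if "x \<in> box (- b) (- a)" for x
    using that by (intro image_eqI[of _ _ "- x"]) (auto simp: mem_box minus_less_iff less_minus_iff)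
  then show ?thesis
    by (auto simp: mem_box)
qed

lemma measure_uminus_image: "measure lebesgue (uminus ` S) = measure lebesgue S"
  for S :: "'a::euclidean_space set"
  using measure_lebesgue_affine[of "-1" 0 S] by simp

lemma box_family_uminus:
  assumes "box_family F"
  shows "box_family ((`) uminus ` F)"
  unfolding box_family_def
proof (intro conjI ballI)
  show "disjoint ((`) uminus ` F)"
  proof (rule disjointI)
    fix B B' assume "B \<in> (`) uminus ` F" "B' \<in> (`) uminus ` F" "B \<noteq> B'"
    then obtain C C' where C: "B = uminus ` C" "B' = uminus ` C'" "C \<in> F" "C' \<in> F" "C \<noteq> C'"
      by blast
    then have "C \<inter> C' = {}"
      using assms by (auto simp: box_family_def disjoint_def)
    then show "B \<inter> B' = {}"
      using C by auto
  qed
  fix B assume "B \<in> (`) uminus ` F"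
  then obtain C where C: "B = uminus ` C" "C \<in> F" by blast
  then show "B \<noteq> {}" "\<exists>a b. B = box a b"
    using assms uminus_image_box unfolding box_family_def by (blast, metis)
qed (use assms in \<open>simp add: box_family_def\<close>)

text \<open>Brunn--Minkowski for the family and its reflection bounds the volume of the difference
  set below by \<open>2 ^ n\<close> times that of the family. The difference set lies in a ball of
  radius \<open>diameter S\<close>, whose volume is \<open>2 ^ n\<close> times that of the ball of
  half the radius.\<close>

lemma isodiametric_box_family:
  fixes S :: "'a::euclidean_space set"
  assumes F: "box_family F" "F \<noteq> {}" "\<Union>F \<subseteq> S" and S: "bounded S"
  shows "measure lebesgue (\<Union>F) \<le> measure lebesgue (ball (0::'a) (diameter S / 2))"
proof -
  let ?n = "DIM('a)" and ?G = "(`) uminus ` F"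
  have d: "0 \<le> diameter S" using S by (rule diameter_ge_0)
  have G: "\<Union>?G = uminus ` \<Union>F" by auto
  have "\<Union>F + \<Union>?G \<subseteq> cball 0 (diameter S)"
  proof
    fix z assume "z \<in> \<Union>F + \<Union>?G"
    then obtain x y where "x \<in> S" "y \<in> S" "z = x - y"
      unfolding G using F(3) by (auto simp: set_plus_def)
    then show "z \<in> cball 0 (diameter S)"
      using diameter_bounded_bound[OF S, of x y] by (simp add: dist_norm norm_minus_commute)
  qed
  then have "measure lebesgue (\<Union>F + \<Union>?G) \<le> measure lebesgue (cball (0::'a) (diameter S))"
    using open_set_plus[OF box_family_open[OF F(1)]] by (intro measure_mono_fmeasurable) (simp_all add: borel_open)
  also have "\<dots> = 2 ^ ?n * measure lebesgue (ball (0::'a) (diameter S / 2))"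
    using content_ball_conv_unit_ball[OF d, of "0::'a"] content_ball_conv_unit_ball[of "diameter S / 2" "0::'a"] d
    by (simp add: content_cball_conv_ball power_divide)
  finally have le: "measure lebesgue (\<Union>F + \<Union>?G) \<le> 2 ^ ?n * measure lebesgue (ball (0::'a) (diameter S / 2))" .
  have "2 * root ?n (measure lebesgue (\<Union>F)) \<le> root ?n (measure lebesgue (\<Union>F + \<Union>?G))"
    using brunn_minkowski_box_family[OF F(1,2) box_family_uminus[OF F(1)]] F(2)
    unfolding G measure_uminus_image by simp
  then have "(2 * root ?n (measure lebesgue (\<Union>F))) ^ ?n \<le> root ?n (measure lebesgue (\<Union>F + \<Union>?G)) ^ ?n"
    by (intro power_mono) auto
  then have "2 ^ ?n * measure lebesgue (\<Union>F) \<le> measure lebesgue (\<Union>F + \<Union>?G)"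
    by (simp add: power_mult_distrib real_root_pow_pos2)
  then have "2 ^ ?n * measure lebesgue (\<Union>F) \<le> 2 ^ ?n * measure lebesgue (ball (0::'a) (diameter S / 2))"
    using le by linarith
  then show ?thesis by simp
qed

text \<open>An open set is exhausted by finite unions of nonoverlapping closed boxes. Passing to
  interiors costs only null sets and yields box families, and the bound survives the limit.\<close>

theorem isodiametric_inequality:
  fixes S :: "'a::euclidean_space set"
  assumes S: "open S" "bounded S" "S \<noteq> {}"
  shows "measure lebesgue S \<le> measure lebesgue (ball (0::'a) (diameter S / 2))"
proof -
  obtain a where a: "S \<subseteq> box (- a) a"
    using bounded_subset_box_symmetric[OF S(2)] by blast
  then have ab: "S \<subseteq> cbox (- a) a" "box (- a) a \<noteq> {}"
    using S(3) box_subset_cbox by blast+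
  \<comment> \<open>The gauge assigns \<open>S\<close> to each point of \<open>S\<close>. Every box
    of the covering is controlled by one of its points in \<open>S\<close> and therefore lies inside
    \<open>S\<close>.\<close>
  have "gauge (\<lambda>x. if x \<in> S then S else UNIV)"
    using S(1) by (auto simp: gauge_def)
  from covering_lemma[OF ab this] obtain \<D> where
    D: "countable \<D>" "\<And>K. K \<in> \<D> \<Longrightarrow> interior K \<noteq> {} \<and> (\<exists>c d. K = cbox c d)"
      "pairwise (\<lambda>A B. interior A \<inter> interior B = {}) \<D>"
      "\<And>K. K \<in> \<D> \<Longrightarrow> \<exists>x \<in> S \<inter> K. K \<subseteq> (if x \<in> S then S else UNIV)" "S \<subseteq> \<Union>\<D>"
    by metis
  have KS: "K \<subseteq> S" if "K \<in> \<D>" for K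
    using D(4)[OF that] by auto
  have ne: "\<D> \<noteq> {}" using D(5) S(3) by auto
  \<comment> \<open>The enumeration repeats members when \<open>\<D>\<close> is finite; this is
    harmless, as the families built from it are sets and only distinct boxes are compared.\<close>
  define K where "K = from_nat_into \<D>"
  have K: "K n \<in> \<D>" for n
    unfolding K_def by (rule from_nat_into[OF ne])
  have rK: "range K = \<D>"
    unfolding K_def by (rule range_from_nat_into[OF ne D(1)])
  have SK: "S = (\<Union>n. \<Union>k\<le>n. K k)"
  proof -
    have "S = \<Union>\<D>" using D(5) KS by blast
    also have "\<dots> = (\<Union>n. \<Union>k\<le>n. K k)" unfolding rK[symmetric] by auto
    finally show ?thesis .
  qed
  have Km: "K n \<in> lmeasurable" for n
    using D(2)[OF K, of n] by auto
  define U where "U n = (\<Union>k\<le>n. K k)" for n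
  have Um: "U n \<in> lmeasurable" for n
    unfolding U_def using Km by (intro fmeasurable.finite_UN) auto
  have bound: "measure lebesgue (U n) \<le> measure lebesgue (ball (0::'a) (diameter S / 2))" for n
  proof -
    define F where "F = (\<lambda>k. interior (K k)) ` {..n}"
    have "disjoint F"
      unfolding F_def
    proof (rule disjointI)
      fix A B assume "A \<in> (\<lambda>k. interior (K k)) ` {..n}" "B \<in> (\<lambda>k. interior (K k)) ` {..n}" "A \<noteq> B"
      then obtain j k where jk: "A = interior (K j)" "B = interior (K k)" "K j \<noteq> K k"
        by (metis (no_types, lifting) imageE)
      then show "A \<inter> B = {}"
        using pairwiseD[OF D(3) K[of j] K[of k]] by simp
    qed
    moreover have "B \<noteq> {} \<and> (\<exists>a b. B = box a b)" if B: "B \<in> F" for B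
    proof -
      obtain k where k: "B = interior (K k)" using B by (auto simp: F_def)
      show ?thesis using D(2)[OF K, of k] k interior_cbox by metis
    qed
    ultimately have F: "box_family F"
      by (simp add: box_family_def F_def)
    have FU: "\<Union>F \<subseteq> U n"
      unfolding F_def U_def using interior_subset by fastforce
    have "negligible (U n - \<Union>F)"
    proof (rule negligible_subset)
      show "negligible (\<Union>k\<le>n. frontier (K k))"
      proof (rule negligible_Union)
        fix T assume "T \<in> (\<lambda>k. frontier (K k)) ` {..n}"
        then obtain k where T: "T = frontier (K k)" by auto
        show "negligible T"
          using D(2)[OF K, of k] unfolding T by (metis convex_box(1) negligible_convex_frontier)
      qed auto
      show "U n - \<Union>F \<subseteq> (\<Union>k\<le>n. frontier (K k))"
        unfolding U_def F_def frontier_def using closure_subset by fastforce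
    qed
    moreover have "sym_diff (U n) (\<Union>F) = U n - \<Union>F" using FU by auto
    ultimately have "measure lebesgue (\<Union>F) = measure lebesgue (U n)"
      using measure_negligible_symdiff[OF Um] by metis
    moreover have "F \<noteq> {}" by (auto simp: F_def)
    moreover have "U n \<subseteq> S" unfolding U_def using K KS by blast
    ultimately show ?thesis
      using isodiametric_box_family[OF F _ _ S(2)] FU by auto
  qed
  have "(\<lambda>n. measure lebesgue (U n)) \<longlonglongrightarrow> measure lebesgue (\<Union>n. U n)"
    by (rule measure_nested_Union[OF Um bound]) (auto simp: U_def le_Suc_eq)
  then have "(\<lambda>n. measure lebesgue (U n)) \<longlonglongrightarrow> measure lebesgue S"
    using SK by (simp add: U_def)
  then show ?thesis
    by (rule LIMSEQ_le_const2) (use bound in blast)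
qed

section \<open>Pointwise bounds from the mean value property\<close>

text \<open>Convexity of the power on the open half-line; the endpoint \<open>t = 0\<close> lies
  outside it and is checked directly.\<close>

lemma powr_above_tangent:
  fixes a t p :: real
  assumes "1 \<le> p" "0 < a" "0 \<le> t"
  shows "a powr p + p * a powr (p - 1) * (t - a) \<le> t powr p"
proof (cases "t = 0")
  case True
  have "a powr (p - 1) * a = a powr p"
    using assms by (simp add: powr_diff)
  then have "p * a powr (p - 1) * (t - a) = - (p * a powr p)"
    using True by simp
  also have "\<dots> \<le> - (a powr p)"
    using assms by (simp add: mult_le_cancel_right1)
  finally show ?thesis using True assms by simp
next
  case False
  have "p * a powr (p - 1) * (t - a) \<le> t powr p - a powr p"
  proof (rule convex_on_imp_above_tangent[OF powr_convex[OF assms(1)]])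
    show "((\<lambda>x. x powr p) has_field_derivative p * a powr (p - 1)) (at a within {0<..})"
      using assms by (auto intro!: derivative_eq_intros simp: has_field_derivative_at_within)
  qed (use assms False in \<open>auto simp: interior_open\<close>)
  then show ?thesis by simp
qed

section \<open>Weak solutions under change of sign\<close>

lemma L2loc_uminus: "L2loc \<Omega> f \<Longrightarrow> L2loc \<Omega> (\<lambda>x. - f x)"
  by (simp add: L2loc_def set_integrable_def)

lemma weak_solution_imp_subsolution:
  assumes "weak_solution A \<Omega> v"
  shows "weak_subsolution A \<Omega> v"
  using assms unfolding weak_solution_def weak_subsolution_def by (metis order.refl)

text \<open>Together with \<open>weak_solution_imp_subsolution\<close> this turns upper bounds for
  subsolutions into two-sided bounds for solutions.\<close>

lemma weak_solution_uminus:
  assumes "weak_solution A \<Omega> v"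
  shows "weak_solution A \<Omega> (\<lambda>x. - v x)"
proof -
  obtain g where g: "H1loc_grad \<Omega> v g"
    "\<And>\<phi>. test_fun \<Omega> \<phi> \<Longrightarrow> integral \<Omega> (\<lambda>x. (A x *v g x) \<bullet> grad \<phi> x) = 0"
    using assms unfolding weak_solution_def by blast
  have "H1loc_grad \<Omega> (\<lambda>x. - v x) (\<lambda>x. - g x)"
    using g(1) L2loc_uminus unfolding H1loc_grad_def weak_gradient_def by auto
  moreover have "integral \<Omega> (\<lambda>x. (A x *v - g x) \<bullet> grad \<phi> x) = 0" if "test_fun \<Omega> \<phi>" for \<phi>
  proof -
    have "A x *v - g x = - (A x *v g x)" for x
      by (simp add: vec_eq_iff matrix_vector_mult_def sum_negf)
    then show ?thesis using g(2)[OF that] by simp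
  qed
  ultimately show ?thesis unfolding weak_solution_def by blast
qed

text \<open>A ball around \<open>x\<close> that leaves \<Omega> would, being connected, meet the
  frontier at a point closer than \<open>infdist\<close>. For an empty frontier
  \<open>infdist\<close> is 0 and the ball is empty.\<close>

lemma ball_subset_of_infdist_frontier:
  fixes x :: "'a::euclidean_space"
  assumes "x \<in> \<Omega>" "R \<le> infdist x (frontier \<Omega>)"
  shows "ball x R \<subseteq> \<Omega>"
proof (rule ccontr)
  assume n: "\<not> ball x R \<subseteq> \<Omega>"
  then have "0 < R" by (metis ball_empty empty_subsetI not_less)
  then have "ball x R \<inter> frontier \<Omega> \<noteq> {}"
    using n assms(1) centre_in_ball[of x R] by (intro connected_Int_frontier) blast+
  then obtain z where "z \<in> frontier \<Omega>" "dist x z < R" by auto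
  then show False using infdist_le[of z "frontier \<Omega>" x] assms(2) by simp
qed

lemma absolutely_integrable_on_bounded_continuous:
  fixes f :: "'a::euclidean_space \<Rightarrow> real"
  assumes "continuous_on S f" "S \<in> lmeasurable" "\<And>x. x \<in> S \<Longrightarrow> \<bar>f x\<bar> \<le> B"
  shows "f absolutely_integrable_on S"
  using assms
  by (intro measurable_bounded_by_integrable_imp_absolutely_integrable[where g="\<lambda>x. B"]
      continuous_imp_measurable_on_sets_lebesgue integrable_on_const) auto

text \<open>The tangent to \<open>t powr p\<close> at \<open>a = u x0 - m\<close> plays the role of Jensen's inequality here.\<close>

lemma subsolution_pointwise_bound:
  fixes u :: "real^'n::finite \<Rightarrow> real"
  assumes mv: "mean_value_constants A \<Omega> c C"
    and u: "continuous_on \<Omega> u" "weak_subsolution A \<Omega> u" "\<And>x. x \<in> \<Omega> \<Longrightarrow> \<bar>u x\<bar> \<le> B"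
    and \<Omega>: "\<Omega> \<in> lmeasurable" and x0: "x0 \<in> \<Omega>"
    and r: "0 < r" "r < infdist x0 (frontier \<Omega>) / C" and p: "1 \<le> p" and m: "m < u x0"
  shows "(u x0 - m) powr p * measure lebesgue (ball x0 (c * r)) \<le> integral \<Omega> (\<lambda>x. \<bar>u x - m\<bar> powr p)"
proof -
  have c: "0 < c" "0 < C" using mv by (auto simp: mean_value_constants_def)
  \<comment> \<open>The mean value property speaks of pairs of radii; the midpoint is an admissible
    larger partner for \<open>r\<close>.\<close>
  define \<rho> where "\<rho> = (r + infdist x0 (frontier \<Omega>) / C) / 2"
  have \<rho>: "r < \<rho>" "\<rho> < infdist x0 (frontier \<Omega>) / C"
    using less_half_sum[OF r(2)] gt_half_sum[OF r(2)] by (simp_all add: \<rho>_def)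
  obtain D where D: "D \<in> sets lebesgue" "ball x0 (c * r) \<subseteq> D" "D \<subseteq> ball x0 (C * r)" "u x0 \<le> avg D u"
    using mv x0 u(1,2) r \<rho> unfolding mean_value_constants_def by meson
  have "C * r \<le> infdist x0 (frontier \<Omega>)"
    using r c by (simp add: pos_less_divide_eq mult.commute)
  then have D\<Omega>: "D \<subseteq> \<Omega>"
    using ball_subset_of_infdist_frontier[OF x0] D(3) by blast
  have Dm: "D \<in> lmeasurable"
    using D(1,3) bounded_subset[OF bounded_ball] by (blast intro: bounded_set_imp_lmeasurable)
  have bD: "measure lebesgue (ball x0 (c * r)) \<le> measure lebesgue D"
    using D(2) Dm by (intro measure_mono_fmeasurable) auto
  have "0 < measure lebesgue (ball x0 (c * r))"
    using content_ball_pos[of "c * r" x0] c r by simp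
  then have pD: "0 < measure lebesgue D" using bD by linarith
  define a where "a = u x0 - m"
  have a: "0 < a" using m by (simp add: a_def)
  have um: "\<bar>u x - m\<bar> powr p \<le> (B + \<bar>m\<bar>) powr p" if "x \<in> \<Omega>" for x
    using u(3)[OF that] p by (intro powr_mono2) auto
  have cont: "continuous_on \<Omega> (\<lambda>x. \<bar>u x - m\<bar> powr p)"
    using u(1) p by (intro continuous_on_powr' continuous_intros) auto
  have int\<Omega>: "(\<lambda>x. \<bar>u x - m\<bar> powr p) absolutely_integrable_on \<Omega>"
    using um by (intro absolutely_integrable_on_bounded_continuous[OF cont \<Omega>, of "(B + \<bar>m\<bar>) powr p"]) auto
  then have intD: "(\<lambda>x. \<bar>u x - m\<bar> powr p) absolutely_integrable_on D"
    using D(1) D\<Omega> by (rule set_integrable_subset)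
  have intu: "u absolutely_integrable_on D"
    using absolutely_integrable_on_bounded_continuous[OF u(1) \<Omega> u(3)] D\<Omega> D(1) set_integrable_subset by blast
  have uint: "u integrable_on D" and cint: "\<And>k::real. (\<lambda>x. k) integrable_on D"
    using intu Dm by (auto simp: set_lebesgue_integral_eq_integral integrable_on_const)
  \<comment> \<open>The average of \<open>u\<close> over \<open>D\<close> is at least
    \<open>u x0\<close>, so the added linear term is nonnegative.\<close>
  have "a powr p * measure lebesgue D \<le> a powr p * measure lebesgue D
      + p * a powr (p - 1) * (integral D u - u x0 * measure lebesgue D)"
    using D(4) pD p by (simp add: avg_def pos_le_divide_eq)
  also have "\<dots> = integral D (\<lambda>x. a powr p + p * a powr (p - 1) * (u x - u x0))"
  proof (rule integral_unique[symmetric])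
    have k: "((\<lambda>x. k) has_integral k * measure lebesgue D) D" for k :: real
    proof -
      have "((\<lambda>x. 1::real) has_integral measure lebesgue D) D"
        using integrable_integral[OF cint[of 1]] lmeasure_integral[OF Dm] by simp
      from has_integral_mult_right[OF this, of k] show ?thesis by simp
    qed
    show "((\<lambda>x. a powr p + p * a powr (p - 1) * (u x - u x0)) has_integral
        a powr p * measure lebesgue D + p * a powr (p - 1) * (integral D u - u x0 * measure lebesgue D)) D"
      by (intro has_integral_add has_integral_mult_right has_integral_diff k integrable_integral uint)
  qed
  also have "\<dots> \<le> integral D (\<lambda>x. \<bar>u x - m\<bar> powr p)"
  proof (rule integral_le)
    fix x assume "x \<in> D"
    \<comment> \<open>The tangent has nonnegative slope, so it only grows when
      \<open>u x - m\<close> is replaced by its absolute value, where the power is defined and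
      convex.\<close>
    have "a powr p + p * a powr (p - 1) * (u x - u x0) \<le> a powr p + p * a powr (p - 1) * (\<bar>u x - m\<bar> - a)"
      using p by (intro add_left_mono mult_left_mono) (auto simp: a_def)
    also have "\<dots> \<le> \<bar>u x - m\<bar> powr p"
      by (rule powr_above_tangent[OF p a]) simp
    finally show "a powr p + p * a powr (p - 1) * (u x - u x0) \<le> \<bar>u x - m\<bar> powr p" .
  next
    show "(\<lambda>x. a powr p + p * a powr (p - 1) * (u x - u x0)) integrable_on D"
      by (intro integrable_add integrable_on_mult_right integrable_diff uint cint)
    show "(\<lambda>x. \<bar>u x - m\<bar> powr p) integrable_on D"
      using intD by (simp add: set_lebesgue_integral_eq_integral)
  qed
  also have "\<dots> \<le> integral \<Omega> (\<lambda>x. \<bar>u x - m\<bar> powr p)"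
    using intD int\<Omega> D\<Omega> by (intro integral_subset_le) (auto simp: set_lebesgue_integral_eq_integral)
  finally have "a powr p * measure lebesgue D \<le> integral \<Omega> (\<lambda>x. \<bar>u x - m\<bar> powr p)" .
  moreover have "a powr p * measure lebesgue (ball x0 (c * r)) \<le> a powr p * measure lebesgue D"
    using bD by (simp add: mult_left_mono)
  ultimately show ?thesis by (simp add: a_def)
qed

section \<open>Hoelder continuity and its seminorm\<close>

lemma holder_imp_continuous_on:
  assumes "holder \<alpha> S v" "0 < \<alpha>"
  shows "continuous_on S v"
proof -
  obtain M where M: "\<And>x y. x \<in> S \<Longrightarrow> y \<in> S \<Longrightarrow> \<bar>v x - v y\<bar> \<le> M * dist x y powr \<alpha>"
    using assms(1) unfolding holder_def by blast
  have "(v \<longlongrightarrow> v x) (at x within S)" if x: "x \<in> S" for x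
  proof -
    have "((\<lambda>y. dist y x powr \<alpha>) \<longlongrightarrow> 0 powr \<alpha>) (at x within S)"
      using assms(2) by (intro tendsto_powr2 tendsto_eq_intros) auto
    then have "((\<lambda>y. M * dist y x powr \<alpha>) \<longlongrightarrow> 0) (at x within S)"
      using assms(2) by (auto intro!: tendsto_eq_intros)
    then have "((\<lambda>y. v y - v x) \<longlongrightarrow> 0) (at x within S)"
      by (rule Lim_null_comparison[rotated]) (use M x in \<open>auto simp: eventually_at_filter\<close>)
    then show ?thesis by (simp add: LIM_zero_iff)
  qed
  then show ?thesis by (simp add: continuous_on_def)
qed

text \<open>Hoelder continuity bounds the set of quotients, so its \<open>Sup\<close> is a genuine
  supremum. Distances appear in units of half the diameter because the seminorm is scaled that
  way.\<close>

lemma holder_seminorm_bound: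
  fixes v :: "real^'n::finite \<Rightarrow> real"
  assumes h: "holder \<alpha> (closure \<Omega>) v" and d: "0 < diameter \<Omega>"
    and xy: "x \<in> closure \<Omega>" "y \<in> closure \<Omega>"
  shows "\<bar>v x - v y\<bar> \<le> holder_seminorm \<alpha> \<Omega> v * (2 * dist x y / diameter \<Omega>) powr \<alpha>"
proof (cases "x = y")
  case False
  let ?S = "{(diameter \<Omega> / 2) powr \<alpha> * \<bar>v x1 - v x2\<bar> / dist x1 x2 powr \<alpha> |
       x1 x2. x1 \<in> closure \<Omega> \<and> x2 \<in> closure \<Omega> \<and> x1 \<noteq> x2}"
  obtain M where M: "\<And>x y. x \<in> closure \<Omega> \<Longrightarrow> y \<in> closure \<Omega> \<Longrightarrow> \<bar>v x - v y\<bar> \<le> M * dist x y powr \<alpha>"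
    using h unfolding holder_def by blast
  have "bdd_above ?S"
  proof (rule bdd_aboveI)
    fix z assume "z \<in> ?S"
    then obtain x1 x2 where z: "z = (diameter \<Omega> / 2) powr \<alpha> * \<bar>v x1 - v x2\<bar> / dist x1 x2 powr \<alpha>"
      "x1 \<in> closure \<Omega>" "x2 \<in> closure \<Omega>" "x1 \<noteq> x2" by blast
    then have "\<bar>v x1 - v x2\<bar> / dist x1 x2 powr \<alpha> \<le> M"
      using M[OF z(2,3)] by (simp add: pos_divide_le_eq)
    then have "(diameter \<Omega> / 2) powr \<alpha> * (\<bar>v x1 - v x2\<bar> / dist x1 x2 powr \<alpha>) \<le> (diameter \<Omega> / 2) powr \<alpha> * M"
      by (rule mult_left_mono) simp
    then show "z \<le> (diameter \<Omega> / 2) powr \<alpha> * M"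
      using z(1) by simp
  qed
  then have "(diameter \<Omega> / 2) powr \<alpha> * \<bar>v x - v y\<bar> / dist x y powr \<alpha> \<le> holder_seminorm \<alpha> \<Omega> v"
    unfolding holder_seminorm_def using xy False by (intro cSup_upper) blast+
  moreover have "(2 * dist x y / diameter \<Omega>) powr \<alpha> = dist x y powr \<alpha> / (diameter \<Omega> / 2) powr \<alpha>"
    using d by (subst powr_divide[symmetric]) (auto simp: mult.commute)
  moreover have "0 < P \<Longrightarrow> 0 < Q \<Longrightarrow> P * w / Q \<le> H \<Longrightarrow> w \<le> H * (Q / P)" for P Q w H :: real
    by (simp add: field_simps)
  moreover have "0 < (diameter \<Omega> / 2) powr \<alpha>" "0 < dist x y powr \<alpha>"
    using d False by auto
  ultimately show ?thesis
    by metis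
qed simp

text \<open>A ball centred on the axis at distance \<open>s\<close> from the vertex touches the
  lateral surface when its radius is \<open>s * sin \<theta>\<close>; its points stay within
  \<open>s * (1 + sin \<theta>)\<close> of the vertex.\<close>

lemma ball_subset_spherical_cone:
  fixes x e :: "real^'n::finite"
  assumes e: "norm e = 1" and \<theta>: "0 < \<theta>" "\<theta> \<le> pi / 2" and s: "0 < s" "s * (1 + sin \<theta>) \<le> h"
  shows "ball (x + s *\<^sub>R e) (s * sin \<theta>) \<subseteq> spherical_cone x e \<theta> h"
proof
  fix y assume "y \<in> ball (x + s *\<^sub>R e) (s * sin \<theta>)"
  define w where "w = y - (x + s *\<^sub>R e)"
  have w: "norm w < s * sin \<theta>"
    using \<open>y \<in> _\<close> by (simp add: w_def dist_norm norm_minus_commute)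
  have y: "y - x = s *\<^sub>R e + w" by (simp add: w_def)
  have sin: "0 < sin \<theta>" "sin \<theta> \<le> 1" using \<theta> by (auto intro: sin_gt_zero)
  have cos: "0 \<le> cos \<theta>" using \<theta> by (intro cos_ge_zero) auto
  have ee: "e \<bullet> e = 1" using e by (simp add: norm_eq_1)
  define a where "a = w \<bullet> e"
  have a: "\<bar>a\<bar> \<le> norm w" unfolding a_def using Cauchy_Schwarz_ineq2[of w e] e by simp
  have "norm w < s" using w sin s by (smt (verit) mult_left_le)
  then have pos: "0 < s + a" using a by linarith
  have inner: "(y - x) \<bullet> e = s + a"
    unfolding y by (simp add: inner_add_left ee a_def)
  have nrm: "(norm (y - x))\<^sup>2 = s\<^sup>2 + 2 * s * a + (norm w)\<^sup>2"
    unfolding y power2_norm_eq_inner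
    by (simp add: inner_add_left inner_add_right ee a_def inner_commute power2_eq_square)
  have "y \<noteq> x" using inner pos by auto
  then have "0 < dist x y" by simp
  moreover have "dist x y < h"
  proof -
    have "dist x y = norm (s *\<^sub>R e + w)" by (metis dist_commute dist_norm y)
    also have "\<dots> \<le> s + norm w" using norm_triangle_ineq[of "s *\<^sub>R e" w] e s by simp
    also have "\<dots> < s * (1 + sin \<theta>)" using w by (simp add: algebra_simps)
    finally show ?thesis using s by simp
  qed
  moreover have "norm (y - x) * cos \<theta> < s + a"
  proof (cases "cos \<theta> = 0")
    case True
    then show ?thesis using pos by simp
  next
    case False
    have s1: "(sin \<theta>)\<^sup>2 = 1 - (cos \<theta>)\<^sup>2" by (simp add: sin_squared_eq)
    have "(norm w)\<^sup>2 < (s * sin \<theta>)\<^sup>2" using w by (intro power_strict_mono) auto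
    then have "0 < (cos \<theta>)\<^sup>2 * ((s * sin \<theta>)\<^sup>2 - (norm w)\<^sup>2)" using False by simp
    \<comment> \<open>Adding this square in \<open>a\<close> produces exactly the difference of the
      squares of the two sides to be compared; strictness comes from \<open>cos \<theta>\<close>
      being nonzero.\<close>
    also have "\<dots> \<le> (a + (sin \<theta>)\<^sup>2 * s)\<^sup>2 + (cos \<theta>)\<^sup>2 * ((s * sin \<theta>)\<^sup>2 - (norm w)\<^sup>2)" by simp
    also have "\<dots> = (s + a)\<^sup>2 - (norm (y - x) * cos \<theta>)\<^sup>2"
      unfolding power_mult_distrib nrm s1 by (simp add: power2_eq_square algebra_simps)
    finally have "(norm (y - x) * cos \<theta>)\<^sup>2 < (s + a)\<^sup>2" by simp
    then show ?thesis using pos by (simp add: power2_less_imp_less)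
  qed
  ultimately show "y \<in> spherical_cone x e \<theta> h"
    by (simp add: spherical_cone_def inner)
qed

text \<open>The ball inscribed in the cone lies in the closure of \<Omega>. It avoids the frontier
  because the closed cone meets it only in the vertex \<open>x\<close>, whose distance
  \<open>s\<close> from the centre is at least the radius.\<close>

lemma cone_condition_interior_ball:
  fixes \<Omega> :: "(real^'n::finite) set"
  assumes cone: "interior_cone_condition \<theta> h \<Omega>" and o: "open \<Omega>" and x: "x \<in> frontier \<Omega>"
    and \<theta>: "0 < \<theta>" "\<theta> \<le> pi / 2" and s: "0 < s" "s * (1 + sin \<theta>) \<le> h"
  obtains y where "y \<in> \<Omega>" "dist x y = s" "s * sin \<theta> \<le> infdist y (frontier \<Omega>)"
proof -
  obtain e where e: "norm e = 1" "spherical_cone x e \<theta> h \<subseteq> closure \<Omega>"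
      "closure (spherical_cone x e \<theta> h) \<inter> frontier \<Omega> = {x}"
    using cone x unfolding interior_cone_condition_def by blast
  define y where "y = x + s *\<^sub>R e"
  have dy: "dist x y = s" using e s by (simp add: y_def dist_norm)
  have sin: "0 < sin \<theta>" "sin \<theta> \<le> 1" using \<theta> by (auto intro: sin_gt_zero)
  have b: "ball y (s * sin \<theta>) \<subseteq> spherical_cone x e \<theta> h"
    unfolding y_def by (rule ball_subset_spherical_cone[OF e(1) \<theta> s])
  have xb: "x \<notin> ball y (s * sin \<theta>)"
    using dy s sin by (simp add: dist_commute not_less)
  have bc: "ball y (s * sin \<theta>) \<subseteq> closure (spherical_cone x e \<theta> h)"
    using b closure_subset by (rule subset_trans)
  have bf: "z \<notin> frontier \<Omega>" if z: "z \<in> ball y (s * sin \<theta>)" for z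
  proof
    assume "z \<in> frontier \<Omega>"
    then have "z \<in> {x}" using subsetD[OF bc z] e(3) by auto
    then show False using xb z by simp
  qed
  have "ball y (s * sin \<theta>) \<subseteq> \<Omega>"
  proof
    fix z assume z: "z \<in> ball y (s * sin \<theta>)"
    then have "z \<in> closure \<Omega>" using b e(2) by (meson subsetD)
    then show "z \<in> \<Omega>" using bf[OF z] interior_open[OF o] by (simp add: frontier_def)
  qed
  then have "y \<in> \<Omega>" using s sin by auto
  moreover have "s * sin \<theta> \<le> infdist y (frontier \<Omega>)"
  proof -
    have "s * sin \<theta> \<le> dist y z" if "z \<in> frontier \<Omega>" for z
      using bf[of z] that by (metis mem_ball not_le)
    moreover have "frontier \<Omega> \<noteq> {}" using x by blast
    ultimately show ?thesis
      unfolding infdist_def by (simp add: cINF_greatest)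
  qed
  ultimately show thesis using that dy by blast
qed

text \<open>The number \<open>s\<close> is the critical point of
  \<open>M * s powr \<alpha> + E * (\<kappa> / s) powr (N / p)\<close>. There the second term is
  \<open>\<alpha> * p / N\<close> times the first, and the first is the product of powers in the
  final estimate.\<close>

lemma optimal_scale:
  fixes N \<alpha> p M E \<kappa> :: real
  assumes pos: "0 < N" "0 < \<alpha>" "0 < p" "0 < M" "0 < E" "0 < \<kappa>"
  defines "s \<equiv> (N / (\<alpha> * p) * \<kappa> powr (N / p) * (E / M)) powr (p / (N + \<alpha> * p))"
  shows "0 < s"
    and "M * s powr \<alpha> = (N / (\<alpha> * p)) powr (\<alpha> * p / (N + \<alpha> * p)) * \<kappa> powr (\<alpha> * N / (N + \<alpha> * p))
      * M powr (N / (N + \<alpha> * p)) * E powr (\<alpha> * p / (N + \<alpha> * p))"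
    and "M * s powr \<alpha> + E * (\<kappa> / s) powr (N / p) = (1 + \<alpha> * p / N) * (M * s powr \<alpha>)"
proof -
  let ?q = "N + \<alpha> * p" and ?b = "N / (\<alpha> * p) * \<kappa> powr (N / p) * (E / M)"
  have q: "0 < ?q" using pos by (simp add: add_pos_pos)
  have b: "0 < ?b" using pos by simp
  then show s0: "0 < s" unfolding s_def by (subst powr_gt_zero) linarith
  have "s powr \<alpha> = ?b powr (\<alpha> * p / ?q)"
    unfolding s_def powr_powr by (simp add: mult.commute)
  also have "\<dots> = (N / (\<alpha> * p)) powr (\<alpha> * p / ?q) * (\<kappa> powr (N / p)) powr (\<alpha> * p / ?q)
      * (E powr (\<alpha> * p / ?q) / M powr (\<alpha> * p / ?q))"
    using pos by (simp add: powr_mult powr_divide)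
  also have "(\<kappa> powr (N / p)) powr (\<alpha> * p / ?q) = \<kappa> powr (\<alpha> * N / ?q)"
    using pos by (simp add: powr_powr mult.commute)
  finally have sa: "s powr \<alpha> = (N / (\<alpha> * p)) powr (\<alpha> * p / ?q) * \<kappa> powr (\<alpha> * N / ?q)
      * (E powr (\<alpha> * p / ?q) / M powr (\<alpha> * p / ?q))" .
  \<comment> \<open>The exponents \<open>N / ?q\<close> and \<open>\<alpha> * p / ?q\<close> are
    complementary, which turns the negative power of \<open>M\<close> into the interpolation
    power.\<close>
  have "M powr (N / ?q) * M powr (\<alpha> * p / ?q) = M powr (N / ?q + \<alpha> * p / ?q)"
    by (simp add: powr_add)
  also have "N / ?q + \<alpha> * p / ?q = 1"
    using q by (simp add: add_divide_distrib[symmetric])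
  finally have "M / M powr (\<alpha> * p / ?q) = M powr (N / ?q)"
    using pos by (simp add: divide_simps)
  then show "M * s powr \<alpha> = (N / (\<alpha> * p)) powr (\<alpha> * p / ?q) * \<kappa> powr (\<alpha> * N / ?q)
      * M powr (N / ?q) * E powr (\<alpha> * p / ?q)"
    unfolding sa by (simp add: divide_inverse mult_ac)
  \<comment> \<open>This is the critical point equation, solved for the power of
    \<open>s\<close>.\<close>
  have "s powr \<alpha> * s powr (N / p) = s powr (?q / p)"
    using pos by (simp add: powr_add[symmetric] field_simps)
  also have "\<dots> = ?b"
    unfolding s_def powr_powr using q pos b by simp
  finally have "s powr \<alpha> * s powr (N / p) = ?b" .
  then have "\<alpha> * p / N * (M * s powr \<alpha>) * s powr (N / p) = E * \<kappa> powr (N / p)"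
    using pos by (simp add: field_simps)
  then have "E * (\<kappa> powr (N / p) / s powr (N / p)) = \<alpha> * p / N * (M * s powr \<alpha>)"
    using s0 pos by (simp add: divide_simps)
  then show "M * s powr \<alpha> + E * (\<kappa> / s) powr (N / p) = (1 + \<alpha> * p / N) * (M * s powr \<alpha>)"
    using s0 pos by (simp add: powr_divide distrib_right)
qed

section \<open>Bounds for solutions in the interior and on the frontier\<close>

lemma diameter_pos_open:
  fixes \<Omega> :: "'a::euclidean_space set"
  assumes "open \<Omega>" "bounded \<Omega>" "\<Omega> \<noteq> {}"
  shows "0 < diameter \<Omega>"
proof -
  obtain x r where "0 < r" "ball x r \<subseteq> \<Omega>"
    using assms by (metis equals0I open_contains_ball)
  then have "2 * r \<le> diameter \<Omega>"
    using diameter_subset[OF _ assms(2), of "ball x r"] diameter_ball[of x r] by simp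
  then show ?thesis using \<open>0 < r\<close> by simp
qed

text \<open>The subsolution estimate is applied to \<open>v\<close> or to \<open>- v\<close>,
  according to the sign of \<open>v y - m\<close>. The isodiametric inequality replaces the volume
  of \<Omega> by that of a ball, so the unit ball volume cancels.\<close>

lemma solution_interior_bound:
  fixes v :: "real^'n::finite \<Rightarrow> real"
  assumes mv: "mean_value_constants A \<Omega> c C" and p: "1 \<le> p" and \<alpha>: "0 < \<alpha>"
    and \<Omega>: "open \<Omega>" "bounded \<Omega>" "\<Omega> \<noteq> {}" and v: "v \<in> Sigma_alpha A \<alpha> \<Omega>"
    and y: "y \<in> \<Omega>" and R: "0 < R" "C * R \<le> infdist y (frontier \<Omega>)"
  shows "\<bar>v y - m\<bar> \<le> npnorm p \<Omega> (\<lambda>x. v x - m) * (diameter \<Omega> / (2 * (c * R))) powr (real CARD('n) / p)"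
proof -
  let ?N = "CARD('n)" and ?\<omega> = "measure lebesgue (ball (0::real^'n) 1)" and ?d = "diameter \<Omega>"
  let ?I = "integral \<Omega> (\<lambda>x. \<bar>v x - m\<bar> powr p)" and ?E = "npnorm p \<Omega> (\<lambda>x. v x - m)"
  have c: "0 < c" "0 < C" using mv by (auto simp: mean_value_constants_def)
  have d: "0 < ?d" using \<Omega> by (rule diameter_pos_open)
  have \<Omega>m: "\<Omega> \<in> lmeasurable" using \<Omega> by (simp add: lmeasurable_open)
  have ws: "weak_solution A \<Omega> v" and hol: "holder \<alpha> (closure \<Omega>) v"
    using v by (auto simp: Sigma_alpha_def)
  have cont: "continuous_on (closure \<Omega>) v"
    using hol \<alpha> by (rule holder_imp_continuous_on)
  then have "bounded (v ` closure \<Omega>)"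
    using \<Omega>(2) by (intro compact_imp_bounded compact_continuous_image) auto
  then obtain B where B: "\<And>x. x \<in> closure \<Omega> \<Longrightarrow> \<bar>v x\<bar> \<le> B"
    by (auto simp: bounded_iff)
  have B': "\<bar>v x\<bar> \<le> B" if "x \<in> \<Omega>" for x
    using B that closure_subset[of \<Omega>] by auto
  have cont': "continuous_on \<Omega> v"
    using cont closure_subset by (rule continuous_on_subset)
  \<comment> \<open>\<open>integral\<close> is 0 for a function that is not integrable, so the sign
    is right in either case.\<close>
  have I0: "0 \<le> ?I" by (metis integral_nonneg not_integrable_integral order.refl powr_ge_zero)
  have \<omega>: "0 < ?\<omega>" using content_ball_pos[of 1 "0::real^'n"] by simp
  have \<Omega>0: "0 < measure lebesgue \<Omega>"
    using \<Omega> \<Omega>m open_not_negligible negligible_iff_measure zero_less_measure_iff by blast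
  have E0: "0 \<le> ?E" by (simp add: npnorm_def)
  have Ep: "?E powr p = ?I / measure lebesgue \<Omega>"
    using p I0 \<Omega>0 by (simp add: npnorm_def powr_powr)
  have vol: "measure lebesgue \<Omega> \<le> (?d / 2) ^ ?N * ?\<omega>"
    using isodiametric_inequality[OF \<Omega>] content_ball_conv_unit_ball[of "?d / 2" "0::real^'n"] d by simp
  have key: "\<bar>v y - m\<bar> powr p * (c * r) ^ ?N \<le> ?E powr p * (?d / 2) ^ ?N" if r: "0 < r" "r < R" for r
  proof -
    have "C * r < C * R" using r c by simp
    then have r': "r < infdist y (frontier \<Omega>) / C"
      using R(2) by (subst pos_less_divide_eq[OF c(2)]) (simp add: mult.commute)
    have "\<bar>v y - m\<bar> powr p * measure lebesgue (ball y (c * r)) \<le> ?I"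
    proof -
      consider "m < v y" | "- m < - v y" | "v y = m" by linarith
      then show ?thesis
      proof cases
        case 1
        then show ?thesis
          using subsolution_pointwise_bound[OF mv cont' weak_solution_imp_subsolution[OF ws] B' \<Omega>m y r(1) r' p 1]
          by simp
      next
        case 2
        have "(- v y - - m) powr p * measure lebesgue (ball y (c * r))
            \<le> integral \<Omega> (\<lambda>x. \<bar>- v x - - m\<bar> powr p)"
          by (rule subsolution_pointwise_bound[OF mv _
                weak_solution_imp_subsolution[OF weak_solution_uminus[OF ws]] _ \<Omega>m y r(1) r' p 2])
            (use cont' B' in \<open>auto intro: continuous_intros\<close>)
        then show ?thesis
          using 2 by (simp add: abs_minus_commute)
      qed (use I0 p in simp)
    qed
    moreover have "measure lebesgue (ball y (c * r)) = (c * r) ^ ?N * ?\<omega>"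
      using content_ball_conv_unit_ball[of "c * r" y] c r by simp
    ultimately have "\<bar>v y - m\<bar> powr p * (c * r) ^ ?N * ?\<omega> \<le> ?E powr p * measure lebesgue \<Omega>"
      using Ep \<Omega>0 by (simp add: mult.assoc)
    also have "\<dots> \<le> ?E powr p * ((?d / 2) ^ ?N * ?\<omega>)"
      using vol by (simp add: mult_left_mono)
    finally have "(\<bar>v y - m\<bar> powr p * (c * r) ^ ?N) * ?\<omega> \<le> (?E powr p * (?d / 2) ^ ?N) * ?\<omega>"
      by (simp add: mult.assoc)
    then show ?thesis using \<omega> by (rule mult_right_le_imp_le)
  qed
  \<comment> \<open>The mean value property needs radii strictly below the limit radius; the
    endpoint \<open>R\<close> is reached by continuity.\<close>
  have "((\<lambda>r. \<bar>v y - m\<bar> powr p * (c * r) ^ ?N) \<longlongrightarrow> \<bar>v y - m\<bar> powr p * (c * R) ^ ?N) (at_left R)"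
    by (intro tendsto_intros)
  moreover have "\<forall>\<^sub>F r in at_left R. \<bar>v y - m\<bar> powr p * (c * r) ^ ?N \<le> ?E powr p * (?d / 2) ^ ?N"
    using eventually_at_left_real[OF R(1)] by eventually_elim (use key in auto)
  ultimately have "\<bar>v y - m\<bar> powr p * (c * R) ^ ?N \<le> ?E powr p * (?d / 2) ^ ?N"
    by (rule tendsto_upperbound) simp
  then have "\<bar>v y - m\<bar> powr p \<le> ?E powr p * (?d / (2 * (c * R))) ^ ?N"
    using c R by (simp add: power_divide power_mult_distrib field_simps)
  also have "(?d / (2 * (c * R))) ^ ?N = (?d / (2 * (c * R))) powr (real ?N)"
    using c R d by (simp add: powr_realpow)
  finally have "(\<bar>v y - m\<bar> powr p) powr (1 / p) \<le> (?E powr p * (?d / (2 * (c * R))) powr (real ?N)) powr (1 / p)"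
    using p by (intro powr_mono2) auto
  then show ?thesis
    using p c R d E0 by (simp add: powr_mult powr_powr)
qed

text \<open>The parameter \<open>s\<close> measures the step along the cone axis in units of half
  the diameter, which makes the Hoelder term exactly \<open>s powr \<alpha>\<close> times the
  seminorm.\<close>

lemma solution_boundary_bound:
  fixes v :: "real^'n::finite \<Rightarrow> real"
  assumes mv: "mean_value_constants A \<Omega> c C" and p: "1 \<le> p" and \<alpha>: "0 < \<alpha>"
    and \<Omega>: "open \<Omega>" "bounded \<Omega>" "\<Omega> \<noteq> {}" and v: "v \<in> Sigma_alpha A \<alpha> \<Omega>"
    and cone: "interior_cone_condition \<theta> h \<Omega>" and \<theta>: "0 < \<theta>" "\<theta> \<le> pi / 2"
    and x: "x \<in> frontier \<Omega>" and s: "0 < s" "s * (1 + sin \<theta>) \<le> 2 * h / diameter \<Omega>"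
  shows "\<bar>v x - m\<bar> \<le> holder_seminorm \<alpha> \<Omega> v * s powr \<alpha>
    + npnorm p \<Omega> (\<lambda>x. v x - m) * (C / (c * sin \<theta>) / s) powr (real CARD('n) / p)"
proof -
  let ?d = "diameter \<Omega>"
  have c: "0 < c" "0 < C" using mv by (auto simp: mean_value_constants_def)
  have d: "0 < ?d" using \<Omega> by (rule diameter_pos_open)
  have sin: "0 < sin \<theta>" using \<theta> by (auto intro: sin_gt_zero)
  define \<sigma> where "\<sigma> = s * ?d / 2"
  have \<sigma>: "0 < \<sigma>" "\<sigma> * (1 + sin \<theta>) \<le> h" "2 * \<sigma> / ?d = s"
    using s d by (auto simp: \<sigma>_def field_simps)
  obtain y where y: "y \<in> \<Omega>" "dist x y = \<sigma>" "\<sigma> * sin \<theta> \<le> infdist y (frontier \<Omega>)"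
    by (rule cone_condition_interior_ball[OF cone \<Omega>(1) x \<theta> \<sigma>(1,2)])
  have "x \<in> closure \<Omega>" "y \<in> closure \<Omega>"
    using x y(1) closure_subset by (auto simp: frontier_def)
  then have 1: "\<bar>v x - v y\<bar> \<le> holder_seminorm \<alpha> \<Omega> v * s powr \<alpha>"
    using holder_seminorm_bound[of \<alpha> \<Omega> v x y] v d y(2) \<sigma>(3) by (simp add: Sigma_alpha_def)
  \<comment> \<open>Chosen so that \<open>C * R\<close> equals the guaranteed distance of
    \<open>y\<close> from the frontier.\<close>
  define R where "R = \<sigma> * sin \<theta> / C"
  have R: "0 < R" "C * R \<le> infdist y (frontier \<Omega>)"
    using \<sigma> sin c y(3) by (auto simp: R_def)
  have "?d / (2 * (c * R)) = C / (c * sin \<theta>) / s"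
    using \<sigma> sin c d s by (simp add: R_def \<sigma>_def field_simps)
  then have 2: "\<bar>v y - m\<bar> \<le> npnorm p \<Omega> (\<lambda>x. v x - m) * (C / (c * sin \<theta>) / s) powr (real CARD('n) / p)"
    using solution_interior_bound[OF mv p \<alpha> \<Omega> v y(1) R, of m] by simp
  show ?thesis using 1 2 by linarith
qed

section \<open>The oscillation estimate\<close>

lemma oscillation_bound:
  fixes v :: "real^'n::finite \<Rightarrow> real"
  assumes mv: "mean_value_constants A \<Omega> c C" and p: "1 \<le> p" and \<alpha>: "0 < \<alpha>"
    and \<Omega>: "open \<Omega>" "bounded \<Omega>" "\<Omega> \<noteq> {}" and v: "v \<in> Sigma_alpha A \<alpha> \<Omega>"
    and cone: "interior_cone_condition \<theta> h \<Omega>" and \<theta>: "0 < \<theta>" "\<theta> \<le> pi / 2" and h: "0 < h"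
    and x: "x1 \<in> frontier \<Omega>" "x2 \<in> frontier \<Omega>"
  shows "v x1 - v x2 \<le>
      max (2 * (1 + \<alpha> * p / real CARD('n)))
          ((diameter \<Omega> / h) powr \<alpha> * (1 + sin \<theta>) powr \<alpha>)
      * (real CARD('n) / (\<alpha> * p)) powr (\<alpha> * p / (real CARD('n) + \<alpha> * p))
      * (C / (c * sin \<theta>)) powr (\<alpha> * real CARD('n) / (real CARD('n) + \<alpha> * p))
      * holder_seminorm \<alpha> \<Omega> v powr (real CARD('n) / (real CARD('n) + \<alpha> * p))
      * npnorm p \<Omega> (\<lambda>x. v x - m) powr (\<alpha> * p / (real CARD('n) + \<alpha> * p))"
proof -
  let ?d = "diameter \<Omega>" and ?N = "real CARD('n)" and ?S = "1 + sin \<theta>"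
  let ?K1 = "2 * (1 + \<alpha> * p / ?N)" and ?K2 = "(?d / h) powr \<alpha> * ?S powr \<alpha>"
  define M where "M = holder_seminorm \<alpha> \<Omega> v"
  define E where "E = npnorm p \<Omega> (\<lambda>x. v x - m)"
  define \<kappa> where "\<kappa> = C / (c * sin \<theta>)"
  define T where "T = (?N / (\<alpha> * p)) powr (\<alpha> * p / (?N + \<alpha> * p)) * \<kappa> powr (\<alpha> * ?N / (?N + \<alpha> * p))
    * M powr (?N / (?N + \<alpha> * p)) * E powr (\<alpha> * p / (?N + \<alpha> * p))"
  have d: "0 < ?d" using \<Omega> by (rule diameter_pos_open)
  have sin: "0 < sin \<theta>" using \<theta> by (auto intro: sin_gt_zero)
  have \<kappa>: "0 < \<kappa>" using mv sin by (auto simp: \<kappa>_def mean_value_constants_def)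
  have N: "0 < ?N" by simp
  have E0: "0 \<le> E" by (simp add: E_def npnorm_def)
  have T0: "0 \<le> T" by (simp add: T_def)
  have cl: "x1 \<in> closure \<Omega>" "x2 \<in> closure \<Omega>" using x by (auto simp: frontier_def)
  have dist: "dist x1 x2 \<le> ?d"
    using diameter_bounded_bound[OF bounded_closure[OF \<Omega>(2)] cl] \<Omega>(2) by (simp add: diameter_closure)
  have hM: "v x1 - v x2 \<le> M * (2 * dist x1 x2 / ?d) powr \<alpha>"
    using holder_seminorm_bound[of \<alpha> \<Omega> v x1 x2] v d cl by (simp add: Sigma_alpha_def M_def)
  \<comment> \<open>Both boundary values are compared with the same constant \<open>m\<close>,
    whence the factor 2.\<close>
  have small: "v x1 - v x2 \<le> 2 * (M * s powr \<alpha> + E * (\<kappa> / s) powr (?N / p))"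
    if s: "0 < s" "s * ?S \<le> 2 * h / ?d" for s
  proof -
    have "\<bar>a - m\<bar> \<le> X \<Longrightarrow> \<bar>b - m\<bar> \<le> X \<Longrightarrow> a - b \<le> 2 * X" for a b X :: real
      by linarith
    then show ?thesis
      using solution_boundary_bound[OF mv p \<alpha> \<Omega> v cone \<theta> x(1) s, of m]
        solution_boundary_bound[OF mv p \<alpha> \<Omega> v cone \<theta> x(2) s, of m]
      unfolding M_def E_def \<kappa>_def by blast
  qed
  have "v x1 - v x2 \<le> max ?K1 ?K2 * T"
  proof (cases "M \<le> 0")
    case True
    \<comment> \<open>For nonpositive \<open>M\<close> the Hoelder estimate gives a nonpositive
      difference, while the right-hand side is nonnegative.\<close>
    then have "M * (2 * dist x1 x2 / ?d) powr \<alpha> \<le> 0"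
      by (simp add: mult_nonpos_nonneg)
    moreover have "0 \<le> ?K1" using N \<alpha> p by simp
    ultimately show ?thesis
      using hM T0 by (smt (verit) max.cobounded1 mult_nonneg_nonneg)
  next
    case M: False
    show ?thesis
    proof (cases "E = 0")
      case True
      \<comment> \<open>For \<open>E = 0\<close> the optimal scale degenerates to 0. Every small
        \<open>s\<close> fits into the cones, so the limit at 0 may be taken; \<open>T\<close>
        vanishes as well.\<close>
      have "((\<lambda>s. 2 * (M * s powr \<alpha>)) \<longlongrightarrow> 2 * (M * 0 powr \<alpha>)) (at_right 0)"
        using \<alpha> by (intro tendsto_intros tendsto_powr2) (auto simp: eventually_at_filter)
      moreover have "\<forall>\<^sub>F s in at_right 0. v x1 - v x2 \<le> 2 * (M * s powr \<alpha>)"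
      proof -
        have "0 < 2 * h / ?d / ?S" using h d sin by simp
        from eventually_at_right_real[OF this] show ?thesis
        proof eventually_elim
          case (elim s)
          then have "0 < s" "s * ?S \<le> 2 * h / ?d"
            using sin pos_less_divide_eq[of ?S s "2 * h / ?d"] by auto
          from small[OF this] show ?case
            using True by simp
        qed
      qed
      ultimately have "v x1 - v x2 \<le> 2 * (M * 0 powr \<alpha>)"
        by (rule tendsto_lowerbound) simp
      then show ?thesis using \<alpha> True p by (simp add: T_def)
    next
      case False
      define s where "s = (?N / (\<alpha> * p) * \<kappa> powr (?N / p) * (E / M)) powr (p / (?N + \<alpha> * p))"
      have pos: "0 < ?N" "0 < \<alpha>" "0 < p" "0 < M" "0 < E" "0 < \<kappa>"
        using N \<alpha> p M False E0 \<kappa> by auto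
      note os = optimal_scale[OF pos, folded s_def]
      have MT: "M * s powr \<alpha> = T" using os(2) by (simp add: T_def)
      have "v x1 - v x2 \<le> ?K1 * T \<or> v x1 - v x2 \<le> ?K2 * T"
      proof (cases "s * ?S \<le> 2 * h / ?d")
        case True
        have "v x1 - v x2 \<le> 2 * ((1 + \<alpha> * p / ?N) * T)"
          using small[OF os(1) True] os(3) MT by simp
        then show ?thesis by (simp only: mult.assoc simp_thms)
      next
        case False
        \<comment> \<open>A scale that does not fit into the cones is so large that
          \<open>?K2 * s powr \<alpha>\<close> is at least \<open>2 powr \<alpha>\<close>, the
          largest factor in the Hoelder estimate for two points at most a diameter apart.\<close>
        have "2 \<le> ?d / h * ?S * s"
          using False h d by (simp add: field_simps)
        then have "2 powr \<alpha> \<le> (?d / h * ?S * s) powr \<alpha>"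
          using \<alpha> by (intro powr_mono2) auto
        also have "\<dots> = ?K2 * s powr \<alpha>"
          using d h sin os(1) by (simp only: powr_mult)
        finally have 2: "M * 2 powr \<alpha> \<le> M * (?K2 * s powr \<alpha>)"
          using pos by (simp add: mult_left_mono)
        have "(2 * dist x1 x2 / ?d) powr \<alpha> \<le> 2 powr \<alpha>"
          using dist d \<alpha> by (intro powr_mono2) (auto simp: pos_divide_le_eq)
        then have "M * (2 * dist x1 x2 / ?d) powr \<alpha> \<le> M * 2 powr \<alpha>"
          using pos by (simp add: mult_left_mono)
        with 2 hM have "v x1 - v x2 \<le> M * (?K2 * s powr \<alpha>)" by linarith
        also have "\<dots> = ?K2 * T" unfolding MT[symmetric] by (simp add: mult_ac)
        finally show ?thesis by simp
      qed
      moreover have "?K1 * T \<le> max ?K1 ?K2 * T" "?K2 * T \<le> max ?K1 ?K2 * T"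
        using T0 by (auto intro: mult_right_mono)
      ultimately show ?thesis by linarith
    qed
  qed
  then show ?thesis
    by (simp add: T_def M_def E_def \<kappa>_def mult.assoc)
qed

text \<open>The frontier of a bounded nonempty open set is compact and nonempty, so
  \<open>Sup\<close> and \<open>Inf\<close> are attained and the estimate for pairs of boundary
  points applies.\<close>

lemma Sigma_alpha_osc_ineq:
  fixes v :: "real^'n::finite \<Rightarrow> real"
  assumes mv: "mean_value_constants A \<Omega> c C" and p: "1 \<le> p" and \<alpha>: "0 < \<alpha>"
    and \<Omega>: "open \<Omega>" "bounded \<Omega>" "\<Omega> \<noteq> {}" and v: "v \<in> Sigma_alpha A \<alpha> \<Omega>"
    and cone: "interior_cone_condition \<theta> h \<Omega>" and \<theta>: "0 < \<theta>" "\<theta> \<le> pi / 2" and h: "0 < h"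
  shows "osc_ineq
      (max (2 * (1 + \<alpha> * p / real CARD('n)))
          ((diameter \<Omega> / h) powr \<alpha> * (1 + sin \<theta>) powr \<alpha>)
      * (real CARD('n) / (\<alpha> * p)) powr (\<alpha> * p / (real CARD('n) + \<alpha> * p))
      * (C / (c * sin \<theta>)) powr (\<alpha> * real CARD('n) / (real CARD('n) + \<alpha> * p))) \<alpha> p \<Omega> v"
proof -
  have ne: "frontier \<Omega> \<noteq> {}"
    using \<Omega> not_bounded_UNIV by (auto simp: frontier_eq_empty)
  have K: "compact (frontier \<Omega>)" using \<Omega>(2) by (rule compact_frontier_bounded)
  have "continuous_on (closure \<Omega>) v"
    using v \<alpha> holder_imp_continuous_on by (auto simp: Sigma_alpha_def)
  then have cont: "continuous_on (frontier \<Omega>) v"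
    by (rule continuous_on_subset) (simp add: frontier_def)
  obtain x1 where x1: "x1 \<in> frontier \<Omega>" "\<And>y. y \<in> frontier \<Omega> \<Longrightarrow> v y \<le> v x1"
    using continuous_attains_sup[OF K ne cont] by blast
  obtain x2 where x2: "x2 \<in> frontier \<Omega>" "\<And>y. y \<in> frontier \<Omega> \<Longrightarrow> v x2 \<le> v y"
    using continuous_attains_inf[OF K ne cont] by blast
  have "Sup (v ` frontier \<Omega>) = v x1" "Inf (v ` frontier \<Omega>) = v x2"
    using x1 x2 by (auto intro!: cSup_eq_maximum cInf_eq_minimum)
  then show ?thesis
    unfolding osc_ineq_def
    using oscillation_bound[OF mv p \<alpha> \<Omega> v cone \<theta> h x1(1) x2(1)] by simp
qed

text \<open>The inequality has the form \<open>Q \<le> K * P\<close> with \<open>P\<close>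
  nonnegative. For positive \<open>P\<close> it says that \<open>K\<close> is at least
  \<open>Q / P\<close>, which passes to the infimum; for \<open>P = 0\<close> it does not depend on
  \<open>K\<close>.\<close>

lemma osc_ineq_optimal_K:
  assumes K0: "0 \<le> K0" "\<And>v. v \<in> Sigma_alpha A \<alpha> \<Omega> \<Longrightarrow> osc_ineq K0 \<alpha> p \<Omega> v"
  shows "optimal_K A \<alpha> p \<Omega> \<le> K0"
    and "v \<in> Sigma_alpha A \<alpha> \<Omega> \<Longrightarrow> osc_ineq (optimal_K A \<alpha> p \<Omega>) \<alpha> p \<Omega> v"
proof -
  let ?S = "{K. 0 \<le> K \<and> (\<forall>v\<in>Sigma_alpha A \<alpha> \<Omega>. osc_ineq K \<alpha> p \<Omega> v)}"
  have K0S: "K0 \<in> ?S" using K0 by blast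
  show "optimal_K A \<alpha> p \<Omega> \<le> K0"
    unfolding optimal_K_def using K0S by (intro cInf_lower bdd_belowI[of _ 0]) auto
  assume v: "v \<in> Sigma_alpha A \<alpha> \<Omega>"
  define P where "P = holder_seminorm \<alpha> \<Omega> v powr (real CARD('a) / (real CARD('a) + \<alpha> * p))
         * npnorm p \<Omega> (\<lambda>x. v x - mean_val \<Omega> v) powr (\<alpha> * p / (real CARD('a) + \<alpha> * p))"
  define Q where "Q = Sup (v ` frontier \<Omega>) - Inf (v ` frontier \<Omega>)"
  have osc: "osc_ineq K \<alpha> p \<Omega> v \<longleftrightarrow> Q \<le> K * P" for K
    by (simp add: osc_ineq_def P_def Q_def mult.assoc)
  have QP: "Q \<le> K * P" if "K \<in> ?S" for K
    using that v osc by blast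
  have "0 \<le> P" by (simp add: P_def)
  then consider "P = 0" | "0 < P" by linarith
  then have "Q \<le> optimal_K A \<alpha> p \<Omega> * P"
  proof cases
    case 1
    then show ?thesis using QP[OF K0S] by simp
  next
    case 2
    have "Q / P \<le> optimal_K A \<alpha> p \<Omega>"
      unfolding optimal_K_def
    proof (rule cInf_greatest)
      show "?S \<noteq> {}" using K0S by blast
      show "Q / P \<le> K" if "K \<in> ?S" for K
        using QP[OF that] 2 by (simp add: pos_divide_le_eq)
    qed
    then show ?thesis using 2 by (simp add: pos_divide_le_eq)
  qed
  then show "osc_ineq (optimal_K A \<alpha> p \<Omega>) \<alpha> p \<Omega> v" by (simp add: osc)
qed

theorem theorem3p1:
  fixes A :: "real^'n::finite \<Rightarrow> real^'n^'n"
    and \<Omega> :: "(real^'n) set"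
    and lam Lam c C p \<alpha> \<theta> h :: real
  assumes "CARD('n) \<ge> 2"
    and "elliptic A lam Lam"
    and "mean_value_constants A \<Omega> c C"
    and "1 \<le> p" and "0 < \<alpha>" and "\<alpha> \<le> 1"
    and "open \<Omega>" and "connected \<Omega>" and "bounded \<Omega>" and "\<Omega> \<noteq> {}"
    and "0 < \<theta>" and "\<theta> \<le> pi / 2" and "0 < h"
    and "interior_cone_condition \<theta> h \<Omega>"
  shows "(\<forall>v\<in>Sigma_alpha A \<alpha> \<Omega>. osc_ineq (optimal_K A \<alpha> p \<Omega>) \<alpha> p \<Omega> v) \<and>
    optimal_K A \<alpha> p \<Omega> \<le>
      max (2 * (1 + \<alpha> * p / real CARD('n)))
          ((diameter \<Omega> / h) powr \<alpha> * (1 + sin \<theta>) powr \<alpha>)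
      * (real CARD('n) / (\<alpha> * p)) powr (\<alpha> * p / (real CARD('n) + \<alpha> * p))
      * (C / (c * sin \<theta>)) powr (\<alpha> * real CARD('n) / (real CARD('n) + \<alpha> * p))"
proof -
  let ?K0 = "max (2 * (1 + \<alpha> * p / real CARD('n)))
          ((diameter \<Omega> / h) powr \<alpha> * (1 + sin \<theta>) powr \<alpha>)
      * (real CARD('n) / (\<alpha> * p)) powr (\<alpha> * p / (real CARD('n) + \<alpha> * p))
      * (C / (c * sin \<theta>)) powr (\<alpha> * real CARD('n) / (real CARD('n) + \<alpha> * p))"
  have K0: "osc_ineq ?K0 \<alpha> p \<Omega> v" if "v \<in> Sigma_alpha A \<alpha> \<Omega>" for v
    using assms(3,4,5,7,9,10) that assms(14,11,12,13) by (rule Sigma_alpha_osc_ineq)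
  \<comment> \<open>The set whose infimum is \<open>optimal_K\<close> admits only nonnegative
    constants.\<close>
  have "0 \<le> 2 * (1 + \<alpha> * p / real CARD('n))"
    using assms(4,5) by simp
  then have "0 \<le> ?K0"
    by (intro mult_nonneg_nonneg) (auto simp: max_def)
  then show ?thesis
    using osc_ineq_optimal_K[OF _ K0] by blast
qed

end
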